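(* Assume $\epsilon_1=0$ and fix $\ell\ge2$. Let $\Phi_\ell:\mathring{\mathcal U}(\epsilon)\to\mathrm{End}_{\mathbb Q(q)}(\mathcal V^{\otimes\ell})$ be the action of $\mathring{\mathcal U}(\epsilon)$ on $\mathcal V^{\otimes\ell}$ and $\Psi_\ell:\mathcal H_\ell(q^{-2})\to\mathrm{End}_{\mathbb Q(q)}(\mathcal V^{\otimes\ell})$ the action of the Hecke algebra. Then $\mathrm{End}_{\mathcal H_\ell(q^{-2})}(\mathcal V^{\otimes\ell})=\Phi_\ell(\mathring{\mathcal U}(\epsilon))$ and $\mathrm{End}_{\mathring{\mathcal U}(\epsilon)}(\mathcal V^{\otimes\ell})=\Psi_\ell(\mathcal H_\ell(q^{-2}))$.
   Context: Fix an integer $n\ge 4$ and $\epsilon=(\epsilon_1,\dots,\epsilon_n)\in\{0,1\}^n$. Let $\mathbb{I}=\{1,\dots,n\}$, $\mathring I=\{1,\dots,n-1\}$, $\alpha_i=\delta_i-\delta_{i+1}$, $\langle\alpha_i,\delta_j^\vee\rangle$ the coefficient of $\delta_j$ in $\alpha_i$, $I_{\rm even}=\{i:\epsilon_i=\epsilon_{i+1}\}$, $I_{\rm odd}$ its complement, $[2]=q+q^{-1}$, $q_j=q$ if $\epsilon_j=0$, $q_j=-q^{-1}$ if $\epsilon_j=1$. $\mathring{\mathcal U}(\epsilon)$ is the $\mathbb{Q}(q)$-algebra generated by pairwise commuting invertible $\omega_j$ ($j\in\mathbb I$) and $e_i,f_i$ ($i\in\mathring I$) with relations $\omega_je_i\omega_j^{-1}=q_j^{\langle\alpha_i,\delta_j^\vee\rangle}e_i$,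 $\omega_jf_i\omega_j^{-1}=q_j^{-\langle\alpha_i,\delta_j^\vee\rangle}f_i$, $e_if_j-f_je_i=\delta_{ij}(k_i-k_i^{-1})/(q-q^{-1})$ with $k_i=\omega_i\omega_{i+1}^{-1}$, $e_i^2=f_i^2=0$ ($i\in I_{\rm odd}$), and the Serre-type relations ($e_ie_j=e_je_i$ for $|i-j|>1$; $e_i^2e_j-(-1)^{\epsilon_i}[2]e_ie_je_i+e_je_i^2=0$ for $i\in I_{\rm even}$, $|i-j|=1$; $e_ie_{i-1}e_ie_{i+1}-e_ie_{i+1}e_ie_{i-1}+e_{i+1}e_ie_{i-1}e_i-e_{i-1}e_ie_{i+1}e_i+(-1)^{\epsilon_i}[2]e_ie_{i-1}e_{i+1}e_i=0$ for $i\in I_{\rm odd}$; same for $f$). (It is the subalgebra of the generalized quantum group $\mathcal U(\epsilon)$ of affine type $A$ generated by these elements.) Tensor products use $\Delta(\omega_j)=\omega_j\otimes\omega_j$, $\Delta(e_i)=e_i\otimes1+k_i^{-1}\otimes e_i$, $\Delta(f_i)=f_i\otimes k_i+1\otimes f_i$. $\mathcal V=\bigoplus_{i\in\mathbb I}\mathbb Q(q)v_i$ with $\omega_iv_j=q_i^{\delta_{ij}}v_j$, $e_kv_j=\delta_{k,j-1}v_{j-1}$, $f_kv_j=\delta_{kj}v_{j+1}$. Let $R:\mathcal V^{\otimes2}\to\mathcal V^{\otimes2}$ be $R(v_i\otimes v_i)=q^{-1}q_i^{-1}v_i\otimes v_i$, $R(v_i\otimes v_j)=q^{-1}v_j\otimes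 v_i$ for $i>j$, $R(v_i\otimes v_j)=(q^{-2}-1)v_i\otimes v_j+q^{-1}v_j\otimes v_i$ for $i<j$. $\mathcal H_\ell(q^{-2})$ is the Iwahori–Hecke algebra over $\mathbb Q(q)$ with generators $h_1,\dots,h_{\ell-1}$, relations $(h_i-q^{-2})(h_i+1)=0$, $h_ih_j=h_jh_i$ ($|i-j|>1$), $h_ih_jh_i=h_jh_ih_j$ ($|i-j|=1$); $\Psi_\ell(h_i)$ acts as $R$ on tensor factors $i,i+1$ and as the identity elsewhere (this defines an action). *)

theory Defs
  imports "HOL-Computational_Algebra.Polynomial" "HOL-Computational_Algebra.Fraction_Field"
begin

type_synonym K = "rat poly fract"

definition qq :: K where "qq = Fract [:0, 1:] 1"

definition qj :: "(nat \<Rightarrow> nat) \<Rightarrow> nat \<Rightarrow> K" where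
  "qj eps j = (if eps j = 0 then qq else - inverse qq)"

text \<open>Operators on V (basis v_1..v_n) as matrices: A a b is the coefficient of v_a in A v_b.\<close>
type_synonym vmat = "nat \<Rightarrow> nat \<Rightarrow> K"

definition idV :: "nat \<Rightarrow> vmat" where
  "idV n a b = (if a = b \<and> a \<in> {1..n} then 1 else 0)"

definition vmult :: "nat \<Rightarrow> vmat \<Rightarrow> vmat \<Rightarrow> vmat" where
  "vmult n A B a b = (\<Sum>c\<in>{1..n}. A a c * B c b)"

definition omegaV :: "nat \<Rightarrow> (nat \<Rightarrow> nat) \<Rightarrow> nat \<Rightarrow> vmat" where
  "omegaV n eps j a b = (if a = b \<and> a \<in> {1..n} then (if a = j then qj eps j else 1) else 0)"

definition omegainvV :: "nat \<Rightarrow> (nat \<Rightarrow> nat) \<Rightarrow> nat \<Rightarrow> vmat" where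
  "omegainvV n eps j a b = (if a = b \<and> a \<in> {1..n} then (if a = j then inverse (qj eps j) else 1) else 0)"

definition kV :: "nat \<Rightarrow> (nat \<Rightarrow> nat) \<Rightarrow> nat \<Rightarrow> vmat" where
  "kV n eps i = vmult n (omegaV n eps i) (omegainvV n eps (i + 1))"

definition kinvV :: "nat \<Rightarrow> (nat \<Rightarrow> nat) \<Rightarrow> nat \<Rightarrow> vmat" where
  "kinvV n eps i = vmult n (omegainvV n eps i) (omegaV n eps (i + 1))"

definition eV :: "nat \<Rightarrow> nat \<Rightarrow> vmat" where
  "eV n k a b = (if b = k + 1 \<and> a = k \<and> b \<in> {1..n} \<and> a \<in> {1..n} then 1 else 0)"

definition fV :: "nat \<Rightarrow> nat \<Rightarrow> vmat" where
  "fV n k a b = (if b = k \<and> a = k + 1 \<and> b \<in> {1..n} \<and> a \<in> {1..n} then 1 else 0)"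

text \<open>V^{\<otimes>l} has basis v_w for index words w of length l with letters in {1..n}.
  Operators on V^{\<otimes>l} are matrices indexed by such words, zero outside.\<close>
type_synonym mat = "nat list \<Rightarrow> nat list \<Rightarrow> K"

definition Tidx :: "nat \<Rightarrow> nat \<Rightarrow> nat list set" where
  "Tidx n l = {w. length w = l \<and> set w \<subseteq> {1..n}}"

definition Endo :: "nat \<Rightarrow> nat \<Rightarrow> mat set" where
  "Endo n l = {M. \<forall>x y. (x \<notin> Tidx n l \<or> y \<notin> Tidx n l) \<longrightarrow> M x y = 0}"

definition mmult :: "nat \<Rightarrow> nat \<Rightarrow> mat \<Rightarrow> mat \<Rightarrow> mat" where
  "mmult n l A B x y = (\<Sum>z\<in>Tidx n l. A x z * B z y)"

definition mid :: "nat \<Rightarrow> nat \<Rightarrow> mat" where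
  "mid n l x y = (if x = y \<and> x \<in> Tidx n l then 1 else 0)"

definition tens :: "vmat \<Rightarrow> mat \<Rightarrow> mat" where
  "tens A B x y = (case x of [] \<Rightarrow> 0 | a # w \<Rightarrow> (case y of [] \<Rightarrow> 0 | b # w' \<Rightarrow> A a b * B w w'))"

fun tpow :: "vmat \<Rightarrow> nat \<Rightarrow> mat" where
  "tpow A 0 = (\<lambda>x y. if x = [] \<and> y = [] then 1 else 0)"
| "tpow A (Suc l) = tens A (tpow A l)"

text \<open>Action of e_i and f_i on V^{\<otimes>l} through the iterated coproduct
  Delta(e_i) = e_i \<otimes> 1 + k_i^-1 \<otimes> e_i, Delta(f_i) = f_i \<otimes> k_i + 1 \<otimes> f_i,
  i.e. Delta^(l) = (id \<otimes> Delta^(l-1)) \<circ> Delta.\<close>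
fun Phi_e :: "nat \<Rightarrow> (nat \<Rightarrow> nat) \<Rightarrow> nat \<Rightarrow> nat \<Rightarrow> mat" where
  "Phi_e n eps i 0 = (\<lambda>x y. 0)"
| "Phi_e n eps i (Suc l) =
     (\<lambda>x y. tens (eV n i) (tpow (idV n) l) x y + tens (kinvV n eps i) (Phi_e n eps i l) x y)"

fun Phi_f :: "nat \<Rightarrow> (nat \<Rightarrow> nat) \<Rightarrow> nat \<Rightarrow> nat \<Rightarrow> mat" where
  "Phi_f n eps i 0 = (\<lambda>x y. 0)"
| "Phi_f n eps i (Suc l) =
     (\<lambda>x y. tens (fV n i) (tpow (kV n eps i) l) x y + tens (idV n) (Phi_f n eps i l) x y)"

definition PhiGens :: "nat \<Rightarrow> (nat \<Rightarrow> nat) \<Rightarrow> nat \<Rightarrow> mat set" where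
  "PhiGens n eps l =
     {tpow (omegaV n eps j) l | j. j \<in> {1..n}} \<union> {tpow (omegainvV n eps j) l | j. j \<in> {1..n}}
   \<union> {Phi_e n eps i l | i. i \<in> {1..n-1}} \<union> {Phi_f n eps i l | i. i \<in> {1..n-1}}"

text \<open>The R-matrix: Rmat a b i j = coefficient of v_a \<otimes> v_b in R(v_i \<otimes> v_j).\<close>
definition Rmat :: "(nat \<Rightarrow> nat) \<Rightarrow> nat \<Rightarrow> nat \<Rightarrow> nat \<Rightarrow> nat \<Rightarrow> K" where
  "Rmat eps a b i j =
     (if i = j then (if a = i \<and> b = i then inverse qq * inverse (qj eps i) else 0)
      else if i > j then (if a = j \<and> b = i then inverse qq else 0)
      else (if a = i \<and> b = j then inverse qq ^ 2 - 1 else 0) + (if a = j \<and> b = i then inverse qq else 0))"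

text \<open>Psi_l(h_i): R on tensor factors i, i+1 (1-based), identity elsewhere.\<close>
definition Psi_h :: "nat \<Rightarrow> (nat \<Rightarrow> nat) \<Rightarrow> nat \<Rightarrow> nat \<Rightarrow> mat" where
  "Psi_h n eps l i x y =
     (if x \<in> Tidx n l \<and> y \<in> Tidx n l \<and> (\<forall>p<l. p \<noteq> i - 1 \<and> p \<noteq> i \<longrightarrow> x ! p = y ! p)
      then Rmat eps (x ! (i - 1)) (x ! i) (y ! (i - 1)) (y ! i) else 0)"

definition PsiGens :: "nat \<Rightarrow> (nat \<Rightarrow> nat) \<Rightarrow> nat \<Rightarrow> mat set" where
  "PsiGens n eps l = {Psi_h n eps l i | i. 1 \<le> i \<and> i \<le> l - 1}"

text \<open>The unital Q(q)-subalgebra of End(V^{\<otimes>l}) generated by a set S; the image of an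
  algebra given by generators under a representation is the subalgebra generated by
  the images of the generators.\<close>
inductive_set alg_gen :: "nat \<Rightarrow> nat \<Rightarrow> mat set \<Rightarrow> mat set" for n l S where
  gen: "A \<in> S \<Longrightarrow> A \<in> alg_gen n l S"
| one: "mid n l \<in> alg_gen n l S"
| add: "A \<in> alg_gen n l S \<Longrightarrow> B \<in> alg_gen n l S \<Longrightarrow> (\<lambda>x y. A x y + B x y) \<in> alg_gen n l S"
| smult: "A \<in> alg_gen n l S \<Longrightarrow> (\<lambda>x y. c * A x y) \<in> alg_gen n l S"
| mult: "A \<in> alg_gen n l S \<Longrightarrow> B \<in> alg_gen n l S \<Longrightarrow> mmult n l A B \<in> alg_gen n l S"

definition commutant :: "nat \<Rightarrow> nat \<Rightarrow> mat set \<Rightarrow> mat set" where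
  "commutant n l S = {M \<in> Endo n l. \<forall>A\<in>S. mmult n l M A = mmult n l A M}"

definition PhiImage :: "nat \<Rightarrow> (nat \<Rightarrow> nat) \<Rightarrow> nat \<Rightarrow> mat set" where
  "PhiImage n eps l = alg_gen n l (PhiGens n eps l)"

definition PsiImage :: "nat \<Rightarrow> (nat \<Rightarrow> nat) \<Rightarrow> nat \<Rightarrow> mat set" where
  "PsiImage n eps l = alg_gen n l (PsiGens n eps l)"

end

theory Submission
  imports Defs "HOL-Library.Multiset"
begin

text \<open>The matrices of the \<open>h\<^sub>i\<close> are symmetric and \<open>K\<close> is an ordered field, so the image of the
  Hecke algebra is closed under transposition and equals its double commutant.  It therefore
  suffices to see that an \<open>M\<close> which commutes with the Hecke algebra and is orthogonal, for the
  trace form, to the image of the quantum group vanishes.  Otherwise a multiple of \<open>M\<close> is regular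
  and nonzero at \<open>q = 1\<close>.  There \<open>M\<close> becomes equivariant under a signed action of the symmetric
  group, and the space of all such specialisations is stable under the operators replacing a single
  letter by another one.  Orthogonality to the weight idempotents kills the diagonal entries, and
  an entry with \<open>k + 1\<close> mismatched positions is, up to a positive integer, an entry with \<open>k\<close>
  mismatched positions of another specialisation; so all entries vanish by induction.\<close>

text \<open>Over an ordered field a nonzero matrix has positive square norm for the trace form.
  Projections onto subspaces therefore exist over \<open>K\<close> itself, and no semisimplicity has
  to be known beforehand; once the first equality is available, the double commutant yields the
  second. Specialisation is used in one direction only: a nonzero \<open>M\<close> leaves a nonzero
  residue at q = 1, and nothing has to be lifted back. Transposes enter through <A^T M, C> = <M, A
  C>: the complement is stable under the transposes of the e_i and f_i. At q = 1 the operator R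
  exchanges two letters, with sign -1 exactly when they are equal and odd. Distinct odd letters
  carry no sign, so this is not the usual super flip, and operators joining non-adjacent letters
  arise as colour commutators. The weights of the ladder operators reproduce exactly these signs, so
  that in the induction equal contributions add up instead of cancelling, and characteristic 0
  finishes the argument.\<close>

lemma finite_Tidx: "finite (Tidx n l)"
  using finite_lists_length_eq[of "{1..n}" l] by (simp add: Tidx_def conj_commute)

lemma Tidx_0: "Tidx n 0 = {[]}"
  by (auto simp: Tidx_def)

lemma Tidx_Cons: "c # x \<in> Tidx n l \<longleftrightarrow> (\<exists>l'. l = Suc l' \<and> c \<in> {1..n} \<and> x \<in> Tidx n l')"
  by (auto simp: Tidx_def)

lemma Nil_Tidx: "[] \<in> Tidx n l \<longleftrightarrow> l = 0"
  by (auto simp: Tidx_def)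

lemma Tidx_mset: "x \<in> Tidx n l \<Longrightarrow> mset y = mset x \<Longrightarrow> y \<in> Tidx n l"
  unfolding Tidx_def using mset_eq_length mset_eq_setD by blast

lemma sum_Tidx_Suc:
  "(\<Sum>z\<in>Tidx n (Suc l). g z) = (\<Sum>c\<in>{1..n}. \<Sum>z\<in>Tidx n l. g (c # z))"
proof -
  have "Tidx n (Suc l) = (\<lambda>(c, z). c # z) ` ({1..n} \<times> Tidx n l)"
    by (auto simp: Tidx_def length_Suc_conv image_iff)
  moreover have "inj_on (\<lambda>(c, z). c # z) ({1..n} \<times> Tidx n l)"
    by (auto simp: inj_on_def)
  ultimately have "(\<Sum>z\<in>Tidx n (Suc l). g z) = (\<Sum>(c, z)\<in>{1..n} \<times> Tidx n l. g (c # z))"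
    by (simp add: sum.reindex case_prod_unfold o_def)
  then show ?thesis by (simp add: sum.cartesian_product)
qed

subsection \<open>Matrix algebra\<close>

lemma EndoD: "M \<in> Endo n l \<Longrightarrow> x \<notin> Tidx n l \<or> y \<notin> Tidx n l \<Longrightarrow> M x y = 0"
  by (auto simp: Endo_def)

lemma Endo_eqI:
  assumes "A \<in> Endo n l" "B \<in> Endo n l" "\<And>x y. x \<in> Tidx n l \<Longrightarrow> y \<in> Tidx n l \<Longrightarrow> A x y = B x y"
  shows "A = B"
  using assms by (intro ext) (metis EndoD)

lemma mid_Endo: "mid n l \<in> Endo n l"
  by (auto simp: Endo_def mid_def)

lemma mmult_Endo: "A \<in> Endo n l \<Longrightarrow> B \<in> Endo n l \<Longrightarrow> mmult n l A B \<in> Endo n l"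
  by (auto simp: Endo_def mmult_def)

lemma mmult_assoc: "mmult n l (mmult n l A B) C = mmult n l A (mmult n l B C)"
proof (intro ext)
  fix x y
  have "mmult n l (mmult n l A B) C x y = (\<Sum>z\<in>Tidx n l. \<Sum>w\<in>Tidx n l. A x w * B w z * C z y)"
    by (simp add: mmult_def sum_distrib_right)
  also have "\<dots> = (\<Sum>w\<in>Tidx n l. \<Sum>z\<in>Tidx n l. A x w * B w z * C z y)"
    by (rule sum.swap)
  also have "\<dots> = mmult n l A (mmult n l B C) x y"
    by (simp add: mmult_def sum_distrib_left mult.assoc)
  finally show "mmult n l (mmult n l A B) C x y = mmult n l A (mmult n l B C) x y" .
qed

lemma mmult_mid_left: "A \<in> Endo n l \<Longrightarrow> mmult n l (mid n l) A = A"
proof (intro ext)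
  fix x y assume A: "A \<in> Endo n l"
  have "mmult n l (mid n l) A x y = (\<Sum>z\<in>Tidx n l. if x = z then A z y else 0)"
    unfolding mmult_def mid_def by (intro sum.cong) auto
  then show "mmult n l (mid n l) A x y = A x y" by (simp add: finite_Tidx EndoD[OF A])
qed

lemma mmult_mid_right: "A \<in> Endo n l \<Longrightarrow> mmult n l A (mid n l) = A"
proof (intro ext)
  fix x y assume A: "A \<in> Endo n l"
  have "mmult n l A (mid n l) x y = (\<Sum>z\<in>Tidx n l. if y = z then A x z else 0)"
    unfolding mmult_def mid_def by (intro sum.cong) auto
  then show "mmult n l A (mid n l) x y = A x y" by (simp add: finite_Tidx EndoD[OF A])
qed

lemma mmult_add_left: "mmult n l (\<lambda>x y. A x y + B x y) C = (\<lambda>x y. mmult n l A C x y + mmult n l B C x y)"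
  by (intro ext) (simp add: mmult_def sum.distrib distrib_right)

lemma mmult_add_right: "mmult n l C (\<lambda>x y. A x y + B x y) = (\<lambda>x y. mmult n l C A x y + mmult n l C B x y)"
  by (intro ext) (simp add: mmult_def sum.distrib distrib_left)

lemma mmult_smult_left: "mmult n l (\<lambda>x y. c * A x y) C = (\<lambda>x y. c * mmult n l A C x y)"
  by (intro ext) (simp add: mmult_def sum_distrib_left mult.assoc)

lemma mmult_smult_right: "mmult n l C (\<lambda>x y. c * A x y) = (\<lambda>x y. c * mmult n l C A x y)"
  by (intro ext) (simp add: mmult_def sum_distrib_left mult.left_commute)

definition mtr :: "mat \<Rightarrow> mat" where "mtr A = (\<lambda>x y. A y x)"

lemma mtr_mmult: "mtr (mmult n l A B) = mmult n l (mtr B) (mtr A)"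
  by (intro ext) (simp add: mtr_def mmult_def mult.commute)

lemma mtr_mtr [simp]: "mtr (mtr A) = A"
  by (simp add: mtr_def)

lemma mtr_Endo: "A \<in> Endo n l \<Longrightarrow> mtr A \<in> Endo n l"
  by (auto simp: Endo_def mtr_def)

lemma alg_gen_Endo:
  assumes "S \<subseteq> Endo n l" "A \<in> alg_gen n l S"
  shows "A \<in> Endo n l"
  using assms(2)
proof induction
  case (gen A)
  then show ?case using assms(1) by auto
qed (auto simp: mid_Endo mmult_Endo, auto simp: Endo_def)

text \<open>Transposition reverses products and fixes the generators. This self-adjointness of the
  Hecke image is what the double commutant argument needs.\<close>

lemma alg_gen_mtr:
  assumes "\<And>A. A \<in> S \<Longrightarrow> mtr A = A" "A \<in> alg_gen n l S"
  shows "mtr A \<in> alg_gen n l S"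
  using assms(2)
proof induction
  case (gen A)
  then show ?case by (simp add: assms(1) alg_gen.gen)
next
  case one
  have "mtr (mid n l) = mid n l" by (intro ext) (auto simp: mtr_def mid_def)
  then show ?case by (simp add: alg_gen.one)
next
  case (add A B)
  then show ?case using alg_gen.add[of "mtr A" n l S "mtr B"] by (simp add: mtr_def)
next
  case (smult A c)
  then show ?case using alg_gen.smult[of "mtr A" n l S c] by (simp add: mtr_def)
next
  case (mult A B)
  then show ?case by (simp add: mtr_mmult alg_gen.mult)
qed

lemma alg_gen_sum:
  "finite I \<Longrightarrow> (\<And>i. i \<in> I \<Longrightarrow> F i \<in> alg_gen n l S) \<Longrightarrow> (\<lambda>x y. \<Sum>i\<in>I. F i x y) \<in> alg_gen n l S"
proof (induction I rule: finite_induct)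
  case empty
  show ?case using alg_gen.smult[OF alg_gen.one, of 0] by simp
next
  case (insert i I)
  then show ?case using alg_gen.add[of "F i" n l S "\<lambda>x y. \<Sum>i\<in>I. F i x y"] by simp
qed

lemma commutant_alg_gen:
  assumes "S \<subseteq> Endo n l"
  shows "commutant n l (alg_gen n l S) = commutant n l S"
proof
  show "commutant n l (alg_gen n l S) \<subseteq> commutant n l S"
    by (auto simp: commutant_def alg_gen.gen)
next
  have "mmult n l M A = mmult n l A M" if "M \<in> commutant n l S" "A \<in> alg_gen n l S" for M A
    using that(2)
  proof induction
    case (mult A B)
    then show ?case by (metis mmult_assoc)
  qed (use that(1) in \<open>auto simp: commutant_def mmult_mid_left mmult_mid_right mmult_add_left
        mmult_add_right mmult_smult_left mmult_smult_right\<close>)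
  then show "commutant n l S \<subseteq> commutant n l (alg_gen n l S)"
    by (auto simp: commutant_def)
qed

lemma mmult_commutant:
  "A \<in> commutant n l S \<Longrightarrow> B \<in> commutant n l S \<Longrightarrow> mmult n l A B \<in> commutant n l S"
  by (simp add: commutant_def mmult_Endo) (metis mmult_assoc)

lemma add_commutant:
  "A \<in> commutant n l S \<Longrightarrow> B \<in> commutant n l S \<Longrightarrow> (\<lambda>x y. A x y + B x y) \<in> commutant n l S"
  by (simp add: commutant_def mmult_add_left mmult_add_right Endo_def)

lemma smult_commutant:
  "A \<in> commutant n l S \<Longrightarrow> (\<lambda>x y. c * A x y) \<in> commutant n l S"
  by (simp add: commutant_def mmult_smult_left mmult_smult_right Endo_def)

lemma mid_commutant: "S \<subseteq> Endo n l \<Longrightarrow> mid n l \<in> commutant n l S"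
  by (auto simp: commutant_def mid_Endo mmult_mid_left mmult_mid_right)

lemma alg_gen_subset_commutant:
  assumes "S \<subseteq> Endo n l" "T \<subseteq> commutant n l S"
  shows "alg_gen n l T \<subseteq> commutant n l S"
proof
  fix A assume "A \<in> alg_gen n l T"
  then show "A \<in> commutant n l S"
    by induction (use assms in \<open>auto simp: mid_commutant add_commutant smult_commutant mmult_commutant\<close>)
qed

lemma mtr_commutant:
  assumes "\<And>A. A \<in> S \<Longrightarrow> mtr A = A" "M \<in> commutant n l S"
  shows "mtr M \<in> commutant n l S"
proof -
  have "mmult n l (mtr M) A = mmult n l A (mtr M)" if "A \<in> S" for A
  proof -
    have "mtr (mmult n l M A) = mtr (mmult n l A M)"
      using assms(2) that by (simp add: commutant_def)
    then show ?thesis using assms(1)[OF that] by (simp add: mtr_mmult)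
  qed
  then show ?thesis using assms(2) by (simp add: commutant_def mtr_Endo)
qed

subsection \<open>Orthogonal projection and the double commutant\<close>

text \<open>Gram-Schmidt, one coordinate at a time: \<open>SY Y\<close> consists of the elements of
  \<open>S\<close> supported in \<open>Y\<close>, and admitting one more coordinate enlarges it by
  at most one dimension. No basis of \<open>S\<close> has to be chosen.\<close>

lemma orthogonal_projection_exists:
  fixes S :: "('a \<Rightarrow> 'k::linordered_field) set"
  assumes "finite X"
    and zero: "(\<lambda>x. 0) \<in> S"
    and add: "\<And>s t. s \<in> S \<Longrightarrow> t \<in> S \<Longrightarrow> (\<lambda>x. s x + t x) \<in> S"
    and smult: "\<And>c s. s \<in> S \<Longrightarrow> (\<lambda>x. c * s x) \<in> S"
    and supp: "\<And>s x. s \<in> S \<Longrightarrow> x \<notin> X \<Longrightarrow> s x = 0"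
  shows "\<exists>s\<in>S. \<forall>t\<in>S. (\<Sum>x\<in>X. s x * t x) = (\<Sum>x\<in>X. v x * t x)"
proof -
  let ?ip = "\<lambda>s t. \<Sum>x\<in>X. s x * t x"
  have ip_add: "?ip (\<lambda>x. s x + c * r x) t = ?ip s t + c * ?ip r t"
    "?ip t (\<lambda>x. s x + c * r x) = ?ip t s + c * ?ip t r" for s r t :: "'a \<Rightarrow> 'k" and c
    by (simp_all add: distrib_right distrib_left sum.distrib sum_distrib_left mult.assoc mult.left_commute)
  define SY where "SY Y = {s \<in> S. \<forall>x. x \<notin> Y \<longrightarrow> s x = 0}" for Y
  have "\<forall>v. \<exists>s\<in>SY Y. \<forall>t\<in>SY Y. ?ip s t = ?ip v t" if "Y \<subseteq> X" for Y
    using finite_subset[OF that \<open>finite X\<close>] that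
  proof (induction Y rule: finite_induct)
    case empty
    have "s = (\<lambda>x. 0)" if "s \<in> SY {}" for s
      using that by (auto simp: SY_def)
    then show ?case using zero by (intro allI bexI[of _ "\<lambda>x. 0"]) (auto simp: SY_def)
  next
    case (insert z Y)
    then have IH: "\<forall>v. \<exists>s\<in>SY Y. \<forall>t\<in>SY Y. ?ip s t = ?ip v t" by blast
    show ?case
    proof (cases "\<forall>t\<in>SY (insert z Y). t z = 0")
      case True
      then have "SY (insert z Y) = SY Y" by (auto simp: SY_def)
      then show ?thesis using IH by simp
    next
      case False
      then obtain t where t: "t \<in> SY (insert z Y)" "t z \<noteq> 0" by blast
      obtain p where p: "p \<in> SY Y" "\<forall>r\<in>SY Y. ?ip p r = ?ip t r" using IH by blast
      \<comment> \<open>The new direction: \<open>t\<close> minus its projection to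
        \<open>SY Y\<close>. It is orthogonal to \<open>SY Y\<close> and still nonzero at
        \<open>z\<close>, since \<open>p\<close> vanishes there.\<close>
      define u where "u = (\<lambda>x. t x + (-1) * p x)"
      have uS: "u \<in> S"
        unfolding u_def using t p by (intro add smult) (auto simp: SY_def)
      have u: "u \<in> SY (insert z Y)" using uS t(1) p(1) by (auto simp: SY_def u_def)
      have uz: "u z \<noteq> 0" using p(1) insert.hyps t(2) by (auto simp: u_def SY_def)
      have orth: "?ip u r = 0" if "r \<in> SY Y" for r
        unfolding u_def ip_add using p(2) that by simp
      have "0 < u z * u z" using uz by (metis not_square_less_zero mult_eq_0_iff linorder_neqE_linordered_idom)
      moreover have "u z * u z \<le> ?ip u u"
        using insert.prems \<open>finite X\<close> by (intro member_le_sum) auto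
      ultimately have pos: "?ip u u \<noteq> 0" by simp
      show ?thesis
      proof
        fix v
        obtain w where w: "w \<in> SY Y" "\<forall>r\<in>SY Y. ?ip w r = ?ip v r" using IH by blast
        define c where "c = ?ip v u / ?ip u u"
        define s where "s = (\<lambda>x. w x + c * u x)"
        have "s \<in> SY (insert z Y)"
          using w(1) u add smult by (auto simp: SY_def s_def)
        moreover have "?ip s r = ?ip v r" if r: "r \<in> SY (insert z Y)" for r
        proof -
          \<comment> \<open>Subtracting this multiple of \<open>u\<close> kills the coordinate
            \<open>z\<close> of \<open>r\<close>, which leaves an element of
            \<open>SY Y\<close>.\<close>
          define k where "k = r z / u z"
          define r' where "r' = (\<lambda>x. r x + (- k) * u x)"
          have "r' x = 0" if "x \<notin> Y" for x
            using that r u uz by (cases "x = z") (auto simp: SY_def r'_def k_def)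
          moreover have "r' \<in> S"
            unfolding r'_def using r u by (intro add smult) (auto simp: SY_def)
          ultimately have r': "r' \<in> SY Y" by (simp add: SY_def)
          have req: "r = (\<lambda>x. r' x + k * u x)" by (simp add: r'_def)
          have wu: "?ip w u = 0" using orth[OF w(1)] by (simp add: mult.commute)
          have "?ip s r = ?ip w r' + c * ?ip u r' + k * (?ip w u + c * ?ip u u)"
            unfolding s_def by (subst req) (simp only: ip_add, simp add: algebra_simps)
          also have "\<dots> = ?ip v r' + k * ?ip v u"
            using w(2) r' orth[OF r'] wu pos by (simp add: c_def)
          also have "\<dots> = ?ip v r" unfolding ip_add(2)[symmetric] by (simp add: r'_def)
          finally show ?thesis .
        qed
        ultimately show "\<exists>s\<in>SY (insert z Y). \<forall>t\<in>SY (insert z Y). ?ip s t = ?ip v t" by blast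
      qed
    qed
  qed
  from this[of X] obtain s where "s \<in> SY X" "\<forall>t\<in>SY X. ?ip s t = ?ip v t" by blast
  moreover have "SY X = S" using supp by (auto simp: SY_def)
  ultimately show ?thesis by blast
qed

section \<open>The trace form tr(A^T B) and projection onto a generated algebra\<close>

definition mip :: "nat \<Rightarrow> nat \<Rightarrow> mat \<Rightarrow> mat \<Rightarrow> K" where
  "mip n l A B = (\<Sum>x\<in>Tidx n l. \<Sum>y\<in>Tidx n l. A x y * B x y)"

lemma mip_add_left: "mip n l (\<lambda>x y. A x y + B x y) C = mip n l A C + mip n l B C"
  by (simp add: mip_def distrib_right sum.distrib)

lemma mip_smult_left: "mip n l (\<lambda>x y. c * A x y) C = c * mip n l A C"
  by (simp add: mip_def sum_distrib_left mult.assoc)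

lemma mip_diff_left: "mip n l (\<lambda>x y. A x y - B x y) C = mip n l A C - mip n l B C"
  by (simp add: mip_def left_diff_distrib sum_subtractf)

lemma mip_sum_left: "mip n l (\<lambda>x y. \<Sum>i\<in>I. F i x y) C = (\<Sum>i\<in>I. mip n l (F i) C)"
  by (induction I rule: infinite_finite_induct) (auto simp: mip_add_left, auto simp: mip_def)

text \<open>Adjointness for the trace form. It governs both the action of the algebra on its
  reproducing kernels and the stability of the orthogonal complement.\<close>

lemma mip_mmult_left: "mip n l (mmult n l A B) C = mip n l B (mmult n l (mtr A) C)"
proof -
  let ?T = "Tidx n l"
  have "mip n l (mmult n l A B) C = (\<Sum>x\<in>?T. \<Sum>y\<in>?T. \<Sum>z\<in>?T. A x z * B z y * C x y)"
    by (simp add: mip_def mmult_def sum_distrib_right)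
  also have "\<dots> = (\<Sum>x\<in>?T. \<Sum>z\<in>?T. \<Sum>y\<in>?T. A x z * B z y * C x y)"
    by (intro sum.cong refl sum.swap)
  also have "\<dots> = (\<Sum>z\<in>?T. \<Sum>x\<in>?T. \<Sum>y\<in>?T. A x z * B z y * C x y)"
    by (rule sum.swap)
  also have "\<dots> = (\<Sum>z\<in>?T. \<Sum>y\<in>?T. \<Sum>x\<in>?T. A x z * B z y * C x y)"
    by (intro sum.cong refl sum.swap)
  also have "\<dots> = mip n l B (mmult n l (mtr A) C)"
    by (simp add: mip_def mmult_def mtr_def sum_distrib_left mult.left_commute mult.assoc)
  finally show ?thesis .
qed

lemma mip_self_eq_0:
  assumes "A \<in> Endo n l" "mip n l A A = 0"
  shows "A = (\<lambda>x y. 0)"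
proof -
  have 1: "(\<Sum>y\<in>Tidx n l. A x y * A x y) = 0" if "x \<in> Tidx n l" for x
    using assms(2) that unfolding mip_def
    by (subst (asm) sum_nonneg_eq_0_iff) (auto simp: finite_Tidx sum_nonneg)
  have "A x y = 0" if "x \<in> Tidx n l" "y \<in> Tidx n l" for x y
    using 1[OF that(1)] that(2)
    by (subst (asm) sum_nonneg_eq_0_iff) (auto simp: finite_Tidx)
  then show ?thesis using assms(1) by (intro ext) (metis EndoD)
qed

lemma alg_gen_projection:
  assumes "S \<subseteq> Endo n l"
  obtains P where "P \<in> alg_gen n l S" "\<And>A. A \<in> alg_gen n l S \<Longrightarrow> mip n l P A = mip n l V A"
proof -
  let ?G = "(\<lambda>A. \<lambda>(x, y). A x y) ` alg_gen n l S" and ?X = "Tidx n l \<times> Tidx n l"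
  have ip: "(\<Sum>p\<in>?X. (\<lambda>(x, y). A x y) p * (\<lambda>(x, y). B x y) p) = mip n l A B" for A B :: mat
    by (simp add: mip_def sum.cartesian_product case_prod_unfold)
  have "\<exists>s\<in>?G. \<forall>t\<in>?G. (\<Sum>p\<in>?X. s p * t p) = (\<Sum>p\<in>?X. (\<lambda>(x, y). V x y) p * t p)"
  proof (rule orthogonal_projection_exists)
    show "finite ?X" by (simp add: finite_Tidx)
    show "(\<lambda>x. 0) \<in> ?G"
      using alg_gen.smult[OF alg_gen.one, of 0] by (auto simp: image_iff fun_eq_iff intro!: bexI)
  next
    fix s t assume "s \<in> ?G" "t \<in> ?G"
    then show "(\<lambda>x. s x + t x) \<in> ?G"
      by (auto simp: image_iff fun_eq_iff intro!: bexI[OF _ alg_gen.add])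
  next
    fix c s assume "s \<in> ?G"
    then show "(\<lambda>x. c * s x) \<in> ?G"
      by (auto simp: image_iff fun_eq_iff intro!: bexI[OF _ alg_gen.smult])
  next
    fix s x assume "s \<in> ?G" "x \<notin> ?X"
    then obtain A where "A \<in> Endo n l" "s = (\<lambda>(x, y). A x y)" using alg_gen_Endo[OF assms] by blast
    then show "s x = 0" using \<open>x \<notin> ?X\<close> EndoD by (cases x) auto
  qed
  then show ?thesis using that ip by auto
qed

text \<open>The matrices \<open>P c d\<close> below form the reproducing kernel of the algebra for the trace form,
  and left multiplication acts on them as on matrix units.  For fixed \<open>b, d\<close> the matrix
  with entries \<open>P c d a b\<close> therefore commutes with the algebra.\<close>
lemma double_commutant:
  assumes S: "S \<subseteq> Endo n l" and sym: "\<And>A. A \<in> S \<Longrightarrow> mtr A = A"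
  shows "commutant n l (commutant n l (alg_gen n l S)) \<subseteq> alg_gen n l S"
proof
  let ?B = "alg_gen n l S" and ?T = "Tidx n l"
  fix X assume X: "X \<in> commutant n l (commutant n l ?B)"
  have BE: "A \<in> Endo n l" if "A \<in> ?B" for A using alg_gen_Endo[OF S that] .
  \<comment> \<open>\<open>P c d\<close> is the projection of the matrix unit at
    \<open>(c, d)\<close> to the algebra.\<close>
  have "\<exists>P. P \<in> ?B \<and> (c \<in> ?T \<longrightarrow> d \<in> ?T \<longrightarrow> (\<forall>A\<in>?B. mip n l P A = A c d))" for c d
  proof -
    obtain P where P: "P \<in> ?B"
      "\<And>A. A \<in> ?B \<Longrightarrow> mip n l P A = mip n l (\<lambda>x y. if x = c then if y = d then 1 else 0 else 0) A"
      using alg_gen_projection[OF S] by metis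
    have "mip n l (\<lambda>x y. if x = c then if y = d then 1 else 0 else 0) A = A c d"
      if "c \<in> ?T" "d \<in> ?T" for A
    proof -
      have "mip n l (\<lambda>x y. if x = c then if y = d then 1 else 0 else 0) A
        = (\<Sum>x\<in>?T. if x = c then \<Sum>y\<in>?T. if y = d then A c d else 0 else 0)"
        unfolding mip_def
      proof (intro sum.cong refl)
        show "(\<Sum>y\<in>?T. (if x = c then if y = d then 1 else 0 else 0) * A x y)
          = (if x = c then \<Sum>y\<in>?T. if y = d then A c d else 0 else 0)" for x
          by (cases "x = c") (simp_all add: finite_Tidx if_distrib[of "\<lambda>t. t * _"] cong: if_cong)
      qed
      then show ?thesis using that by (simp add: finite_Tidx)
    qed
    then show ?thesis using P by auto
  qed
  then obtain P where PB: "\<And>c d. P c d \<in> ?B"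
    and rep: "\<And>c d A. c \<in> ?T \<Longrightarrow> d \<in> ?T \<Longrightarrow> A \<in> ?B \<Longrightarrow> mip n l (P c d) A = A c d"
    by metis
  have eqI: "A = B" if "A \<in> ?B" "B \<in> ?B" "\<And>C. C \<in> ?B \<Longrightarrow> mip n l A C = mip n l B C" for A B
  proof -
    have D: "(\<lambda>x y. A x y - B x y) \<in> ?B"
      using alg_gen.add[OF that(1) alg_gen.smult[OF that(2), of "-1"]] by simp
    then have "(\<lambda>x y. A x y - B x y) = (\<lambda>x y. 0)"
      using that(3)[OF D] by (intro mip_self_eq_0[OF BE]) (auto simp: mip_diff_left)
    then show ?thesis by (simp add: fun_eq_iff)
  qed
  have left: "mmult n l A (P c d) = (\<lambda>x y. \<Sum>k\<in>?T. A k c * P k d x y)"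
    if A: "A \<in> ?B" and cd: "c \<in> ?T" "d \<in> ?T" for A c d
  proof (rule eqI)
    show "mmult n l A (P c d) \<in> ?B" using A PB alg_gen.mult by blast
    show "(\<lambda>x y. \<Sum>k\<in>?T. A k c * P k d x y) \<in> ?B"
      by (intro alg_gen_sum finite_Tidx alg_gen.smult PB)
    fix C assume C: "C \<in> ?B"
    have tA: "mtr A \<in> ?B" using alg_gen_mtr[OF sym A] by blast
    have "mip n l (mmult n l A (P c d)) C = mmult n l (mtr A) C c d"
      using rep[OF cd alg_gen.mult[OF tA C]] by (simp add: mip_mmult_left)
    also have "\<dots> = (\<Sum>k\<in>?T. A k c * mip n l (P k d) C)"
      using rep C cd by (simp add: mmult_def mtr_def)
    also have "\<dots> = mip n l (\<lambda>x y. \<Sum>k\<in>?T. A k c * P k d x y) C"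
      by (simp add: mip_sum_left mip_smult_left)
    finally show "mip n l (mmult n l A (P c d)) C = mip n l (\<lambda>x y. \<Sum>k\<in>?T. A k c * P k d x y) C" .
  qed
  have unit: "(\<lambda>x y. \<Sum>c\<in>?T. P c c x y) = mid n l"
  proof (rule eqI)
    show "(\<lambda>x y. \<Sum>c\<in>?T. P c c x y) \<in> ?B" by (intro alg_gen_sum finite_Tidx PB)
    show "mid n l \<in> ?B" by (rule alg_gen.one)
    fix C assume C: "C \<in> ?B"
    have "mip n l (mid n l) C = (\<Sum>x\<in>?T. \<Sum>y\<in>?T. if x = y then C x x else 0)"
      unfolding mip_def mid_def by (intro sum.cong refl) auto
    then show "mip n l (\<lambda>x y. \<Sum>c\<in>?T. P c c x y) C = mip n l (mid n l) C"
      using rep C by (simp add: mip_sum_left finite_Tidx)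
  qed
  define Q where "Q b d = (\<lambda>x y. if x \<in> ?T \<and> y \<in> ?T then P y d x b else 0)" for b d
  have Q: "Q b d \<in> commutant n l ?B" if "b \<in> ?T" "d \<in> ?T" for b d
  proof -
    have QE: "Q b d \<in> Endo n l" by (auto simp: Q_def Endo_def)
    have "mmult n l (Q b d) A = mmult n l A (Q b d)" if A: "A \<in> ?B" for A
    proof (rule Endo_eqI[OF mmult_Endo[OF QE BE[OF A]] mmult_Endo[OF BE[OF A] QE]])
      fix x y assume xy: "x \<in> ?T" "y \<in> ?T"
      have "mmult n l A (P y d) x b = (\<Sum>k\<in>?T. A k y * P k d x b)"
        using left[OF A xy(2) \<open>d \<in> ?T\<close>] by simp
      then show "mmult n l (Q b d) A x y = mmult n l A (Q b d) x y"
        using xy by (simp add: mmult_def Q_def mult.commute)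
    qed
    then show ?thesis using QE by (simp add: commutant_def)
  qed
  have XE: "X \<in> Endo n l" using X by (simp add: commutant_def)
  \<comment> \<open>Expand \<open>X\<close> as \<open>X\<close> times the sum of the
    \<open>P c c\<close>. The entries of \<open>P c c\<close> in column \<open>b\<close> are those
    of \<open>Q b c\<close> in column \<open>c\<close>, and \<open>X\<close> may be moved to the
    other side of \<open>Q b c\<close>; the result is a combination of kernels.\<close>
  have "X = (\<lambda>x y. \<Sum>c\<in>?T. \<Sum>k\<in>?T. X k c * P k c x y)" (is "_ = ?R")
  proof (rule Endo_eqI[OF XE])
    show "?R \<in> Endo n l" using EndoD[OF BE[OF PB]] by (auto simp: Endo_def)
    fix a b assume ab: "a \<in> ?T" "b \<in> ?T"
    have "mmult n l X (Q b c) = mmult n l (Q b c) X" if "c \<in> ?T" for c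
      using X Q[OF ab(2) that] by (simp add: commutant_def)
    then have e: "mmult n l X (Q b c) a c = mmult n l (Q b c) X a c" if "c \<in> ?T" for c
      using that by simp
    have "X a b = mmult n l X (mid n l) a b" using mmult_mid_right[OF XE] by simp
    also have "\<dots> = (\<Sum>c\<in>?T. mmult n l X (P c c) a b)"
      unfolding unit[symmetric] mmult_def sum_distrib_left by (rule sum.swap)
    also have "\<dots> = (\<Sum>c\<in>?T. mmult n l X (Q b c) a c)"
      using ab by (intro sum.cong refl) (simp add: mmult_def Q_def)
    also have "\<dots> = (\<Sum>c\<in>?T. mmult n l (Q b c) X a c)"
      by (intro sum.cong refl e)
    also have "\<dots> = ?R a b"
      using ab by (intro sum.cong refl) (simp add: mmult_def Q_def mult.commute)
    finally show "X a b = ?R a b" .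
  qed
  also have "?R \<in> ?B" by (intro alg_gen_sum finite_Tidx alg_gen.smult PB)
  finally show "X \<in> ?B" .
qed

subsection \<open>Specialisation at q = 1\<close>

text \<open>\<open>at1 c r\<close>: the rational function \<open>c\<close> is regular at \<open>q = 1\<close> with value \<open>r\<close>.\<close>
definition at1 :: "K \<Rightarrow> rat \<Rightarrow> bool" where
  "at1 c r \<longleftrightarrow> (\<exists>a b. poly b 1 \<noteq> 0 \<and> c = Fract a b \<and> r = poly a 1 / poly b 1)"

lemma at1_unique:
  assumes "at1 c r" "at1 c s"
  shows "r = s"
proof -
  obtain a b a' b' where b: "poly b 1 \<noteq> 0" "poly b' 1 \<noteq> 0" and c: "c = Fract a b" "c = Fract a' b'"
    and r: "r = poly a 1 / poly b 1" "s = poly a' 1 / poly b' 1"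
    using assms unfolding at1_def by metis
  have "b \<noteq> 0" "b' \<noteq> 0" using b by auto
  then have "a * b' = a' * b" using c eq_fract(1) by blast
  then have "poly a 1 * poly b' 1 = poly a' 1 * poly b 1" by (metis poly_mult)
  then show ?thesis using b r by (simp add: frac_eq_eq)
qed

lemma at1_add:
  assumes "at1 c r" "at1 d s"
  shows "at1 (c + d) (r + s)"
proof -
  obtain a b a' b' where b: "poly b 1 \<noteq> 0" "poly b' 1 \<noteq> 0" and c: "c = Fract a b" "d = Fract a' b'"
    and r: "r = poly a 1 / poly b 1" "s = poly a' 1 / poly b' 1"
    using assms unfolding at1_def by metis
  have "b \<noteq> 0" "b' \<noteq> 0" using b by auto
  then have "c + d = Fract (a * b' + a' * b) (b * b')" by (simp add: c)
  then show ?thesis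
    unfolding at1_def using b r by (intro exI[of _ "a * b' + a' * b"] exI[of _ "b * b'"]) (simp add: add_frac_eq)
qed

lemma at1_mult:
  assumes "at1 c r" "at1 d s"
  shows "at1 (c * d) (r * s)"
proof -
  obtain a b a' b' where b: "poly b 1 \<noteq> 0" "poly b' 1 \<noteq> 0" and c: "c = Fract a b" "d = Fract a' b'"
    and r: "r = poly a 1 / poly b 1" "s = poly a' 1 / poly b' 1"
    using assms unfolding at1_def by metis
  then show ?thesis
    unfolding at1_def by (intro exI[of _ "a * a'"] exI[of _ "b * b'"]) simp
qed

lemma at1_0: "at1 0 0"
  unfolding at1_def by (intro exI[of _ 0] exI[of _ 1]) (simp add: Zero_fract_def)

lemma at1_1: "at1 1 1"
  unfolding at1_def by (intro exI[of _ 1]) (simp add: One_fract_def)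

lemma at1_minus_1: "at1 (- 1) (- 1)"
  unfolding at1_def by (intro exI[of _ "-1"] exI[of _ 1]) (simp add: One_fract_def)

lemma at1_minus: "at1 c r \<Longrightarrow> at1 (- c) (- r)"
  using at1_mult[OF at1_minus_1, of c r] by simp

lemma at1_diff: "at1 c r \<Longrightarrow> at1 d s \<Longrightarrow> at1 (c - d) (r - s)"
  using at1_add[OF _ at1_minus] by fastforce

lemma at1_qq: "at1 qq 1"
  unfolding at1_def by (intro exI[of _ "[:0, 1:]"] exI[of _ 1]) (simp add: qq_def)

lemma at1_inverse_qq: "at1 (inverse qq) 1"
  unfolding at1_def by (intro exI[of _ 1] exI[of _ "[:0, 1:]"]) (simp add: qq_def)

lemma at1_sum:
  "(\<And>i. i \<in> I \<Longrightarrow> at1 (f i) (g i)) \<Longrightarrow> at1 (\<Sum>i\<in>I. f i) (\<Sum>i\<in>I. g i)"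
  by (induction I rule: infinite_finite_induct) (auto intro: at1_add at1_0)

lemma at1_prod_list:
  "(\<And>i. i \<in> set xs \<Longrightarrow> at1 (f i) (g i)) \<Longrightarrow> at1 (prod_list (map f xs)) (prod_list (map g xs))"
  by (induction xs) (auto intro: at1_mult at1_1)

lemma qq_nonzero [simp]: "qq \<noteq> 0"
  by (simp add: qq_def Zero_fract_def eq_fract)

lemma qj_nonzero [simp]: "qj eps j \<noteq> 0"
  by (simp add: qj_def)

lemma qq_power: "qq ^ m = Fract (monom 1 m) 1"
proof (induction m)
  case (Suc m)
  then show ?case by (simp add: qq_def monom_Suc)
qed (simp add: One_fract_def monom_0 flip: one_pCons)

lemma qq_power_inject: "qq ^ i = qq ^ j \<longleftrightarrow> i = j"
  by (simp add: qq_power eq_fract) (metis degree_monom_eq one_neq_zero)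

text \<open>Squaring removes the sign of -q^{-1}. The distinctness of these powers separates the
  eigenvalues of \<omega>_j in the interpolation for weight idempotents.\<close>

lemma qj_power_inject: "qj eps k ^ i = qj eps k ^ j \<longleftrightarrow> i = j"
proof
  assume "qj eps k ^ i = qj eps k ^ j"
  then have "(qj eps k ^ i) ^ 2 = (qj eps k ^ j) ^ 2" by simp
  then have e: "(qj eps k ^ 2) ^ i = (qj eps k ^ 2) ^ j" by (simp flip: power_mult add: mult.commute)
  show "i = j"
  proof (cases "eps k = 0")
    case True
    then have "qq ^ (2 * i) = qq ^ (2 * j)" using e True by (simp add: qj_def power_mult)
    then show ?thesis by (simp only: qq_power_inject mult_cancel1) simp
  next
    case False
    then have "inverse (qq ^ (2 * i)) = inverse (qq ^ (2 * j))"
      using e by (simp add: qj_def power_inverse power_mult)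
    then show ?thesis by (simp only: inverse_eq_iff_eq qq_power_inject mult_cancel1) simp
  qed
qed simp

lemma common_denominator:
  assumes "finite X"
  shows "\<exists>D. D \<noteq> 0 \<and> (\<forall>x\<in>X. \<exists>p::rat poly. Fract D 1 * f x = Fract p 1)"
  using assms
proof (induction X rule: finite_induct)
  case (insert x X)
  then obtain D where D: "D \<noteq> 0" "\<forall>x\<in>X. \<exists>p. Fract D 1 * f x = Fract p 1" by blast
  obtain a b where ab: "f x = Fract a b" "b \<noteq> 0" by (cases "f x") auto
  have "Fract (D * b) 1 * f y = Fract b 1 * (Fract D 1 * f y)" for y
  proof -
    have "Fract (D * b) 1 = Fract b 1 * Fract D 1" by (simp add: mult.commute)
    then show ?thesis by (simp only: mult.assoc)
  qed
  moreover have "Fract (D * b) 1 * f x = Fract (D * a) 1"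
    using ab by (simp add: eq_fract)
  ultimately have "\<exists>p. Fract (D * b) 1 * f y = Fract p 1" if "y \<in> insert x X" for y
  proof (cases "y = x")
    case True
    then show ?thesis using \<open>Fract (D * b) 1 * f x = Fract (D * a) 1\<close> by blast
  next
    case False
    then have "y \<in> X" using that by simp
    then obtain p where "Fract D 1 * f y = Fract p 1" using D(2) by blast
    then have "Fract (D * b) 1 * f y = Fract (b * p) 1"
      using \<open>\<And>y. Fract (D * b) 1 * f y = Fract b 1 * (Fract D 1 * f y)\<close>[of y] by simp
    then show ?thesis by blast
  qed
  then show ?case using D(1) ab(2) by (intro exI[of _ "D * b"]) auto
qed (auto intro: exI[of _ 1])

text \<open>Divide by the largest power of \<open>q - 1\<close> dividing all the numerators.\<close>
lemma scale_at1:
  assumes "finite X" "z \<in> X" "f z \<noteq> 0"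
  obtains c g where "\<And>x. x \<in> X \<Longrightarrow> at1 (c * f x) (g x)" "\<exists>x\<in>X. g x \<noteq> 0"
proof -
  obtain D p where D: "D \<noteq> 0" and p: "\<And>x. x \<in> X \<Longrightarrow> Fract D 1 * f x = Fract (p x) 1"
    using common_denominator[OF assms(1), of f] by metis
  have "Fract D 1 \<noteq> 0" using D by (simp add: Zero_fract_def eq_fract)
  then have pz: "p z \<noteq> 0" using p[OF assms(2)] assms(3) by (auto simp: Zero_fract_def[symmetric])
  let ?Y = "{x \<in> X. p x \<noteq> 0}" and ?t = "[:- 1, 1:] :: rat poly"
  define k where "k = Min ((\<lambda>x. order 1 (p x)) ` ?Y)"
  have fin: "finite ((\<lambda>x. order 1 (p x)) ` ?Y)" using assms(1) by simp
  have "k \<in> (\<lambda>x. order 1 (p x)) ` ?Y"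
    unfolding k_def using assms(2) pz by (intro Min_in fin) auto
  then obtain w where w: "w \<in> X" "p w \<noteq> 0" "order 1 (p w) = k" by auto
  have "?t ^ k dvd p x" if "x \<in> X" for x
  proof (cases "p x = 0")
    case False
    then have "k \<le> order 1 (p x)" unfolding k_def using that by (intro Min_le fin) auto
    then show ?thesis using order_1[of 1 "p x"] le_imp_power_dvd dvd_trans by blast
  qed simp
  then obtain r where r: "\<And>x. x \<in> X \<Longrightarrow> p x = ?t ^ k * r x" unfolding dvd_def by metis
  have t: "?t ^ k \<noteq> 0" by simp
  have "poly (r w) 1 \<noteq> 0"
  proof
    assume "poly (r w) 1 = 0"
    then have "?t dvd r w" by (simp add: poly_eq_0_iff_dvd)
    then have "?t ^ k * ?t dvd p w" unfolding r[OF w(1)] by (rule mult_dvd_mono[OF dvd_refl])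
    then have "?t ^ Suc k dvd p w" by (simp only: power_Suc2)
    then show False using order_2[OF w(2), of 1] w(3) by simp
  qed
  moreover have "at1 (Fract D (?t ^ k) * f x) (poly (r x) 1)" if "x \<in> X" for x
  proof -
    have "Fract D (?t ^ k) * f x = Fract 1 (?t ^ k) * (Fract D 1 * f x)"
      by (simp flip: mult.assoc)
    also have "\<dots> = Fract (r x) 1"
      using r[OF that] t by (simp add: p[OF that] eq_fract)
    finally show ?thesis unfolding at1_def by (intro exI[of _ "r x"] exI[of _ 1]) simp
  qed
  ultimately show ?thesis using that[of "Fract D (?t ^ k)" "\<lambda>x. poly (r x) 1"] w(1) by blast
qed

subsection \<open>Ladder and exchange operators on functions of words\<close>

lemma prod_list_ones [simp]: "prod_list (map (\<lambda>_. 1::'k::comm_ring_1) x) = 1"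
  by (induction x) auto

text \<open>A matrix acts on a function \<open>g\<close> of words by \<open>x \<mapsto> \<Sum>z. A x z * g z\<close>.  In this sense \<open>hop k h b a\<close>
  is \<open>\<Sum> k \<otimes> \<dots> \<otimes> k \<otimes> E\<^sub>b\<^sub>a \<otimes> h \<otimes> \<dots> \<otimes> h\<close> for diagonal \<open>k, h\<close>, and \<open>rop d s i\<close> is the matrix
  with diagonal part \<open>d\<close> and swap part \<open>s\<close> on the tensor factors \<open>i, i + 1\<close>, counted from 0.\<close>
fun hop :: "(nat \<Rightarrow> 'k) \<Rightarrow> (nat \<Rightarrow> 'k) \<Rightarrow> nat \<Rightarrow> nat \<Rightarrow> (nat list \<Rightarrow> 'k) \<Rightarrow> nat list \<Rightarrow> 'k::comm_ring_1" where
  "hop k h b a g [] = 0"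
| "hop k h b a g (c # x) =
     (if c = b then prod_list (map h x) * g (a # x) else 0) + k c * hop k h b a (\<lambda>u. g (c # u)) x"

lemma hop_add: "hop k h b a (\<lambda>u. f u + g u) x = hop k h b a f x + hop k h b a g x"
  by (induction x arbitrary: f g) (auto simp: algebra_simps)

lemma hop_smult: "hop k h b a (\<lambda>u. s * g u) x = s * hop k h b a g x"
  by (induction x arbitrary: g) (auto simp: algebra_simps)

lemma hop_0: "hop k h b a (\<lambda>u. 0) x = 0"
  by (induction x) auto

lemma hop_if: "hop k h b a (\<lambda>u. if P then g u else 0) x = (if P then hop k h b a g x else 0)"
  by (simp add: hop_0)

fun rop :: "(nat \<Rightarrow> nat \<Rightarrow> 'k) \<Rightarrow> (nat \<Rightarrow> nat \<Rightarrow> 'k) \<Rightarrow> nat \<Rightarrow> (nat list \<Rightarrow> 'k) \<Rightarrow> nat list \<Rightarrow> 'k::comm_ring_1" where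
  "rop d s 0 g (a # b # x) = d a b * g (a # b # x) + s a b * g (b # a # x)"
| "rop d s (Suc i) g (c # x) = rop d s i (\<lambda>u. g (c # u)) x"
| "rop d s i g x = 0"

lemma rop_add: "rop d s i (\<lambda>u. f u + g u) x = rop d s i f x + rop d s i g x"
proof (induction d s i f x arbitrary: g rule: rop.induct)
  case (2 d s i f c x)
  show ?case using "2"[of "\<lambda>u. g (c # u)"] by simp
qed (auto simp: algebra_simps)

lemma rop_smult: "rop d s i (\<lambda>u. t * g u) x = t * rop d s i g x"
  by (induction d s i g x rule: rop.induct) (auto simp: algebra_simps)

lemma rop_0: "rop d s i (\<lambda>u. 0) x = 0"
  using rop_smult[of d s i 0] by simp

text \<open>The weight h \<otimes> ... \<otimes> h depends only on the multiset of letters, which an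
  exchange preserves. This settles the \<omega>_j and also the factors lying to the right of a
  replaced letter.\<close>

lemma rop_diag:
  "rop d s i (\<lambda>u. prod_list (map h u) * g u) x = prod_list (map h x) * rop d s i g x"
proof (induction d s i g x rule: rop.induct)
  case (2 d s i g c x)
  have "rop d s (Suc i) (\<lambda>u. prod_list (map h u) * g u) (c # x)
      = rop d s i (\<lambda>u. h c * (prod_list (map h u) * g (c # u))) x"
    by (simp add: mult.assoc)
  also have "\<dots> = prod_list (map h (c # x)) * rop d s (Suc i) g (c # x)"
    by (simp only: rop_smult "2.IH" rop.simps) (simp add: mult.assoc)
  finally show ?case .
qed (auto simp: algebra_simps)

lemma at1_hop:
  assumes "x \<in> Tidx n l" "a \<in> {1..n}" "\<And>c. at1 (k c) (k' c)" "\<And>c. at1 (h c) (h' c)"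
    "\<And>u. u \<in> Tidx n l \<Longrightarrow> at1 (g u) (g' u)"
  shows "at1 (hop k h b a g x) (hop k' h' b a g' x)"
  using assms(1,5)
proof (induction x arbitrary: l g g')
  case (Cons c x)
  then obtain l' where l: "l = Suc l'" "c \<in> {1..n}" "x \<in> Tidx n l'" by (auto simp: Tidx_Cons)
  have "at1 (hop k h b a (\<lambda>u. g (c # u)) x) (hop k' h' b a (\<lambda>u. g' (c # u)) x)"
    using l by (intro Cons.IH[of l']) (auto intro!: Cons.prems simp: Tidx_Cons)
  moreover have "at1 (g (a # x)) (g' (a # x))"
    using l assms(2) by (intro Cons.prems) (auto simp: Tidx_Cons)
  ultimately show ?case
    by (auto intro!: at1_add at1_mult at1_prod_list assms at1_0)
qed (simp add: at1_0)

lemma at1_rop: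
  assumes "x \<in> Tidx n l" "\<And>a b. at1 (d a b) (d' a b)" "\<And>a b. at1 (s a b) (s' a b)"
    "\<And>u. u \<in> Tidx n l \<Longrightarrow> at1 (g u) (g' u)"
  shows "at1 (rop d s i g x) (rop d' s' i g' x)"
  using assms
proof (induction d s i g x arbitrary: l g' rule: rop.induct)
  case (1 d s g a b x)
  then show ?case by (auto intro!: at1_add at1_mult simp: Tidx_Cons)
next
  case (2 d s i g c x)
  then obtain l' where l: "l = Suc l'" "c \<in> {1..n}" "x \<in> Tidx n l'" by (auto simp: Tidx_Cons)
  show ?case unfolding rop.simps using l
    by (intro "2.IH"[of l']) (auto intro!: "2.prems" simp: Tidx_Cons)
qed (auto simp: at1_0)

text \<open>The colour commutator of two root vectors; the signs \<open>t\<close> are the values of a symmetric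
  bicharacter.\<close>
lemma hop_commutator:
  fixes t :: "nat \<Rightarrow> nat \<Rightarrow> 'k::comm_ring_1"
  assumes t: "\<And>a b. a \<noteq> b \<Longrightarrow> t a b = 1" "\<And>a b. t a b * t a b = 1"
    and "a \<noteq> b" "b \<noteq> c" "a \<noteq> c"
  defines "k \<equiv> \<lambda>a b e. t a e * t b e"
  shows "hop (k b a) (\<lambda>_. 1) b a (hop (k a c) (\<lambda>_. 1) a c g) x
       - t a a * hop (k a c) (\<lambda>_. 1) a c (hop (k b a) (\<lambda>_. 1) b a g) x
       = hop (k b c) (\<lambda>_. 1) b c g x"
proof (induction x arbitrary: g)
  case (Cons e x)
  \<comment> \<open>The contribution of the intermediate letter \<open>a\<close> occurs twice and
    squares to 1.\<close>
  have kk: "k b a e * k a c e = k b c e" for e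
  proof -
    have "k b a e * k a c e = (t a e * t a e) * (t b e * t c e)"
      by (simp only: k_def mult.assoc mult.left_commute mult.commute)
    then show ?thesis by (simp add: t(2) k_def)
  qed
  have k1: "k a c b = 1" "k a c a = t a a" "k b a c = 1" "k b a a = t a a"
    using assms(3-5) by (auto simp: k_def t(1))
  have IH': "hop (k b c) (\<lambda>_. 1) b c (\<lambda>u. g (e # u)) x =
     hop (k b a) (\<lambda>_. 1) b a (hop (k a c) (\<lambda>_. 1) a c (\<lambda>u. g (e # u))) x
       - t a a * hop (k a c) (\<lambda>_. 1) a c (hop (k b a) (\<lambda>_. 1) b a (\<lambda>u. g (e # u))) x" for e
    using Cons.IH[of "\<lambda>u. g (e # u)"] by simp
  show ?case
    using assms(3-5)
    by (cases "e = a"; cases "e = b")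
       (auto simp: hop_add hop_smult hop_0 hop_if k1 IH' algebra_simps simp flip: kk[of a] kk[of b] kk[of e])
qed simp

text \<open>Multiplying by the weight of the whole word turns the weight of the suffix into that of
  the prefix, because every \<open>k c\<close> squares to 1; the factor \<open>k b\<close> accounts
  for the replaced position. It reconciles the coproducts of e_i and f_i, which put their weights on
  opposite sides.\<close>

lemma hop_suffix_prefix:
  assumes "\<And>c. k c * k c = 1"
  shows "hop k (\<lambda>_. 1) b a g x = k b * (prod_list (map k x) * hop (\<lambda>_. 1) k b a g x)"
proof (induction x arbitrary: g)
  case (Cons c x)
  have "prod_list (map k x) * prod_list (map k x) = 1" for x
  proof (induction x)
    case (Cons c x)
    have "prod_list (map k (c # x)) * prod_list (map k (c # x)) = (k c * k c) * (prod_list (map k x) * prod_list (map k x))"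
      by (simp only: list.map prod_list.Cons mult.assoc mult.left_commute mult.commute)
    then show ?case using Cons assms by simp
  qed simp
  then have "k b * k b * (prod_list (map k x) * prod_list (map k x)) * g (a # x) = g (a # x)"
    using assms by simp
  then show ?case using Cons.IH[of "\<lambda>u. g (c # u)"] by (auto simp: algebra_simps)
qed simp

lemma hop_append:
  "hop k (\<lambda>_. 1) b a g (u @ v) =
    hop k (\<lambda>_. 1) b a (\<lambda>u'. g (u' @ v)) u + prod_list (map k u) * hop k (\<lambda>_. 1) b a (\<lambda>v'. g (u @ v')) v"
proof (induction u arbitrary: g)
  case (Cons c u)
  show ?case by (simp add: Cons.IH algebra_simps)
qed simp

lemma hop_eq_0:
  assumes "\<And>j. j < length x \<Longrightarrow> x ! j = b \<Longrightarrow> g (x[j := a]) = 0"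
  shows "hop k h b a g x = 0"
  using assms
proof (induction x arbitrary: g)
  case (Cons c x)
  have "hop k h b a (\<lambda>u. g (c # u)) x = 0"
    using Cons.prems[of "Suc _"] by (intro Cons.IH) auto
  then show ?case using Cons.prems[of 0] by simp
qed simp

subsection \<open>The generators as operators on functions of words\<close>

definition dg :: "nat \<Rightarrow> (nat \<Rightarrow> K) \<Rightarrow> vmat" where
  "dg n h a b = (if a = b \<and> a \<in> {1..n} then h a else 0)"

definition kf :: "(nat \<Rightarrow> nat) \<Rightarrow> nat \<Rightarrow> nat \<Rightarrow> K" where
  "kf eps i c = (if c = i then qj eps i else 1) * (if c = Suc i then inverse (qj eps (Suc i)) else 1)"

definition kinvf :: "(nat \<Rightarrow> nat) \<Rightarrow> nat \<Rightarrow> nat \<Rightarrow> K" where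
  "kinvf eps i c = (if c = i then inverse (qj eps i) else 1) * (if c = Suc i then qj eps (Suc i) else 1)"

lemma vmult_dg: "vmult n (dg n h) (dg n h') = dg n (\<lambda>a. h a * h' a)"
proof (intro ext)
  fix a b
  have "vmult n (dg n h) (dg n h') a b = (\<Sum>c\<in>{1..n}. if a = c then h a * dg n h' a b else 0)"
    unfolding vmult_def by (intro sum.cong) (auto simp: dg_def)
  then show "vmult n (dg n h) (dg n h') a b = dg n (\<lambda>a. h a * h' a) a b"
    by (auto simp: dg_def)
qed

lemma idV_dg: "idV n = dg n (\<lambda>_. 1)"
  by (intro ext) (simp add: idV_def dg_def)

lemma omegaV_dg: "omegaV n eps j = dg n (\<lambda>a. if a = j then qj eps j else 1)"
  by (intro ext) (simp add: omegaV_def dg_def)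

lemma omegainvV_dg: "omegainvV n eps j = dg n (\<lambda>a. if a = j then inverse (qj eps j) else 1)"
  by (intro ext) (simp add: omegainvV_def dg_def)

lemma kV_dg: "kV n eps i = dg n (kf eps i)"
  unfolding kV_def omegaV_dg omegainvV_dg vmult_dg by (simp add: kf_def fun_eq_iff dg_def)

lemma kinvV_dg: "kinvV n eps i = dg n (kinvf eps i)"
  unfolding kinvV_def omegaV_dg omegainvV_dg vmult_dg by (simp add: kinvf_def fun_eq_iff dg_def)

lemma tpow_dg: "tpow (dg n h) l x y = (if x = y \<and> x \<in> Tidx n l then prod_list (map h x) else 0)"
proof (induction l arbitrary: x y)
  case (Suc l)
  then show ?case
    by (cases x; cases y) (auto simp: tens_def dg_def Tidx_Cons Nil_Tidx)
qed (auto simp: Tidx_0)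

lemma tpow_dg_Endo: "tpow (dg n h) l \<in> Endo n l"
  by (auto simp: Endo_def tpow_dg)

lemma tpow_dg_sum:
  "x \<in> Tidx n l \<Longrightarrow> (\<Sum>z\<in>Tidx n l. tpow (dg n h) l x z * g z) = prod_list (map h x) * g x"
proof -
  assume x: "x \<in> Tidx n l"
  have "(\<Sum>z\<in>Tidx n l. tpow (dg n h) l x z * g z) = (\<Sum>z\<in>Tidx n l. if x = z then prod_list (map h x) * g x else 0)"
    using x by (intro sum.cong) (auto simp: tpow_dg)
  then show ?thesis using x by (simp add: finite_Tidx)
qed

definition unitV :: "nat \<Rightarrow> nat \<Rightarrow> nat \<Rightarrow> vmat" where
  "unitV n b a x y = (if x = b \<and> y = a \<and> b \<in> {1..n} \<and> a \<in> {1..n} then 1 else 0)"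

text \<open>A common form of the two actions: e_i has k_i^{-1} on the left and 1 on the right, f_i
  has 1 on the left and k_i on the right.\<close>

fun hmat :: "nat \<Rightarrow> (nat \<Rightarrow> K) \<Rightarrow> (nat \<Rightarrow> K) \<Rightarrow> nat \<Rightarrow> nat \<Rightarrow> nat \<Rightarrow> mat" where
  "hmat n k h b a 0 = (\<lambda>x y. 0)"
| "hmat n k h b a (Suc l) =
     (\<lambda>x y. tens (unitV n b a) (tpow (dg n h) l) x y + tens (dg n k) (hmat n k h b a l) x y)"

lemma Phi_e_hmat: "Phi_e n eps i l = hmat n (kinvf eps i) (\<lambda>_. 1) i (Suc i) l"
proof (induction l)
  case (Suc l)
  have "eV n i = unitV n i (Suc i)" by (intro ext) (auto simp: eV_def unitV_def)
  then show ?case using Suc by (simp add: kinvV_dg idV_dg)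
qed simp

lemma Phi_f_hmat: "Phi_f n eps i l = hmat n (\<lambda>_. 1) (kf eps i) (Suc i) i l"
proof (induction l)
  case (Suc l)
  have "fV n i = unitV n (Suc i) i" by (intro ext) (auto simp: fV_def unitV_def)
  then show ?case using Suc by (simp add: kV_dg idV_dg)
qed simp

lemma hmat_Endo: "hmat n k h b a l \<in> Endo n l"
proof -
  have "x \<in> Tidx n l \<and> y \<in> Tidx n l" if "hmat n k h b a l x y \<noteq> 0" for x y
    using that
  proof (induction l arbitrary: x y)
    case (Suc l)
    then show ?case
      by (cases x; cases y)
         (auto simp: tens_def dg_def unitV_def tpow_dg Tidx_Cons split: if_splits)
  qed simp
  then show ?thesis by (auto simp: Endo_def)
qed

lemma mtr_hmat: "mtr (hmat n k h b a l) = hmat n k h a b l"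
proof -
  have "hmat n k h b a l y x = hmat n k h a b l x y" for x y
  proof (induction l arbitrary: x y)
    case (Suc l)
    have "tens (unitV n b a) (tpow (dg n h) l) y x = tens (unitV n a b) (tpow (dg n h) l) x y"
      by (auto simp: tens_def unitV_def tpow_dg split: list.splits)
    moreover have "tens (dg n k) (hmat n k h b a l) y x = tens (dg n k) (hmat n k h a b l) x y"
      by (auto simp: tens_def dg_def Suc.IH split: list.splits)
    ultimately show ?case by simp
  qed simp
  then show ?thesis by (simp add: mtr_def fun_eq_iff)
qed

lemma hmat_sum:
  assumes "a \<in> {1..n}" "b \<in> {1..n}"
  shows "x \<in> Tidx n l \<Longrightarrow> (\<Sum>z\<in>Tidx n l. hmat n k h b a l x z * g z) = hop k h b a g x"
proof (induction x arbitrary: l g)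
  case Nil
  then show ?case by (auto simp: Nil_Tidx)
next
  case (Cons c x)
  then obtain l' where l: "l = Suc l'" "c \<in> {1..n}" "x \<in> Tidx n l'" by (auto simp: Tidx_Cons)
  have "(\<Sum>z\<in>Tidx n l. hmat n k h b a l (c # x) z * g z)
     = (\<Sum>d\<in>{1..n}. unitV n b a c d * (\<Sum>z\<in>Tidx n l'. tpow (dg n h) l' x z * g (d # z)))
     + (\<Sum>d\<in>{1..n}. dg n k c d * (\<Sum>z\<in>Tidx n l'. hmat n k h b a l' x z * g (d # z)))"
    unfolding l(1) sum_Tidx_Suc
    by (simp add: tens_def distrib_right sum.distrib sum_distrib_left mult.assoc)
  also have "(\<Sum>d\<in>{1..n}. unitV n b a c d * (\<Sum>z\<in>Tidx n l'. tpow (dg n h) l' x z * g (d # z)))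
    = (\<Sum>d\<in>{1..n}. if d = a then if c = b then prod_list (map h x) * g (a # x) else 0 else 0)"
    using l assms by (intro sum.cong) (auto simp: unitV_def tpow_dg_sum)
  also have "(\<Sum>d\<in>{1..n}. dg n k c d * (\<Sum>z\<in>Tidx n l'. hmat n k h b a l' x z * g (d # z)))
    = (\<Sum>d\<in>{1..n}. if c = d then k c * hop k h b a (\<lambda>u. g (c # u)) x else 0)"
    using l by (intro sum.cong) (auto simp: dg_def Cons.IH)
  finally show ?case using l(2) assms by simp
qed

definition dR :: "(nat \<Rightarrow> nat) \<Rightarrow> nat \<Rightarrow> nat \<Rightarrow> K" where
  "dR eps a b = (if a = b then inverse qq * inverse (qj eps a) else if a > b then 0 else inverse qq ^ 2 - 1)"

text \<open>For equal letters the exchange is the identity, so the whole entry is assigned to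
  \<open>dR\<close> and the swap part is set to 0.\<close>

definition sR :: "nat \<Rightarrow> nat \<Rightarrow> K" where
  "sR a b = (if a = b then 0 else inverse qq)"

lemma Rmat_split:
  "Rmat eps a b c d = (if c = a then if d = b then dR eps a b else 0 else 0)
     + (if c = b then if d = a then sR a b else 0 else 0)"
  by (auto simp: Rmat_def dR_def sR_def)

lemma Psi_h_first:
  "Psi_h n eps (Suc (Suc l)) (Suc 0) (a # b # x) (c # d # z) =
    (if a \<in> {1..n} \<and> b \<in> {1..n} \<and> c \<in> {1..n} \<and> d \<in> {1..n} \<and> x \<in> Tidx n l \<and> z = x
     then Rmat eps a b c d else 0)"
proof -
  have "(\<forall>p<Suc (Suc l). p \<noteq> Suc 0 - 1 \<and> p \<noteq> Suc 0 \<longrightarrow> (a # b # x) ! p = (c # d # z) ! p) \<longleftrightarrow> z = x"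
    if "x \<in> Tidx n l" "z \<in> Tidx n l"
    using that by (auto simp: All_less_Suc2 Tidx_def intro!: nth_equalityI)
  then show ?thesis by (auto simp: Psi_h_def Tidx_Cons)
qed

lemma Psi_h_later:
  "Psi_h n eps (Suc l) (Suc (Suc i)) (c # x) (d # z) =
    (if c = d \<and> c \<in> {1..n} then Psi_h n eps l (Suc i) x z else 0)"
  by (auto simp: Psi_h_def Tidx_Cons All_less_Suc2)

lemma Psi_h_sum:
  "Suc i < l \<Longrightarrow> x \<in> Tidx n l \<Longrightarrow>
     (\<Sum>z\<in>Tidx n l. Psi_h n eps l (Suc i) x z * g z) = rop (dR eps) sR i g x"
proof (induction i arbitrary: l x g)
  case 0
  then obtain l' where l: "l = Suc (Suc l')" using less_iff_Suc_add[of "Suc 0" l] by auto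
  obtain a b y where x: "x = a # b # y" "a \<in> {1..n}" "b \<in> {1..n}" "y \<in> Tidx n l'"
    using 0(2) unfolding l by (cases x; cases "tl x") (auto simp: Tidx_Cons Nil_Tidx)
  have "(\<Sum>z\<in>Tidx n l. Psi_h n eps l (Suc 0) x z * g z)
    = (\<Sum>c\<in>{1..n}. \<Sum>d\<in>{1..n}. \<Sum>z\<in>Tidx n l'. if z = y then Rmat eps a b c d * g (c # d # y) else 0)"
    unfolding l x sum_Tidx_Suc using x by (intro sum.cong refl) (auto simp: Psi_h_first)
  also have "\<dots> = (\<Sum>c\<in>{1..n}. \<Sum>d\<in>{1..n}. Rmat eps a b c d * g (c # d # y))"
    using x by (simp add: finite_Tidx)
  also have "\<dots> = (\<Sum>c\<in>{1..n}. \<Sum>d\<in>{1..n}. (if c = a then if d = b then dR eps a b * g (a # b # y) else 0 else 0)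
     + (if c = b then if d = a then sR a b * g (b # a # y) else 0 else 0))"
    by (intro sum.cong refl) (auto simp: Rmat_split distrib_right)
  also have "\<dots> = (\<Sum>c\<in>{1..n}. (if c = a then dR eps a b * g (a # b # y) else 0)
     + (if c = b then sR a b * g (b # a # y) else 0))"
    using x by (intro sum.cong refl) (auto simp: sum.distrib)
  also have "\<dots> = rop (dR eps) sR 0 g x"
    using x by (simp add: sum.distrib)
  finally show ?case .
next
  case (Suc i)
  then obtain l' where l: "l = Suc l'" by (cases l) auto
  obtain c y where x: "x = c # y" "c \<in> {1..n}" "y \<in> Tidx n l'"
    using Suc.prems(2) unfolding l by (cases x) (auto simp: Tidx_Cons Nil_Tidx)
  have "(\<Sum>z\<in>Tidx n l. Psi_h n eps l (Suc (Suc i)) x z * g z)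
    = (\<Sum>d\<in>{1..n}. if c = d then \<Sum>z\<in>Tidx n l'. Psi_h n eps l' (Suc i) y z * g (c # z) else 0)"
    unfolding l x sum_Tidx_Suc using x by (intro sum.cong refl) (auto simp: Psi_h_later)
  then show ?case using x Suc l by simp
qed

lemma Psi_h_Endo: "Psi_h n eps l i \<in> Endo n l"
  by (auto simp: Endo_def Psi_h_def)

lemma mtr_Psi_h: "mtr (Psi_h n eps l i) = Psi_h n eps l i"
proof -
  have "Rmat eps a b c d = Rmat eps c d a b" for a b c d
    by (auto simp: Rmat_split dR_def sR_def)
  then show ?thesis by (auto simp: mtr_def Psi_h_def fun_eq_iff)
qed

subsection \<open>The two actions commute\<close>

text \<open>Reduction to two tensor factors. A letter replaced to the right of the exchanged pair
  contributes \<open>k\<close> on both of its factors, one replaced to the left contributes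
  \<open>h\<close> on both, and these weights are symmetric. Only a replacement inside the pair is
  left, which is the assumption \<open>two\<close>.\<close>

lemma hop_rop_commute:
  assumes two: "\<And>G c e. (if c = b then h e * (d a e * G a e + s a e * G e a) else 0)
      + k c * (if e = b then d c a * G c a + s c a * G a c else 0)
    = d c e * ((if c = b then h e * G a e else 0) + k c * (if e = b then G c a else 0))
      + s c e * ((if e = b then h c * G a c else 0) + k e * (if c = b then G e a else 0))"
  shows "Suc i < length x \<Longrightarrow> hop k h b a (rop d s i g) x = rop d s i (hop k h b a g) x"
proof (induction i arbitrary: x g)
  case 0
  then obtain c e y where x: "x = c # e # y" by (cases x; cases "tl x") auto
  show ?case
    using two[of c e "\<lambda>u v. prod_list (map h y) * g (u # v # y)"]
    by (auto simp: x hop_add hop_smult algebra_simps split: if_splits)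
next
  case (Suc i)
  then obtain c y where x: "x = c # y" "Suc i < length y" by (cases x) auto
  have "rop d s i (\<lambda>u. hop k h b a g (c # u)) y
     = rop d s i (\<lambda>u. prod_list (map h u) * (if c = b then g (a # u) else 0)) y
       + rop d s i (\<lambda>u. k c * hop k h b a (\<lambda>u. g (c # u)) u) y"
    unfolding rop_add[symmetric] by (intro arg_cong[of _ _ "\<lambda>f. rop d s i f y"]) auto
  also have "\<dots> = prod_list (map h y) * rop d s i (\<lambda>u. if c = b then g (a # u) else 0) y
       + k c * rop d s i (\<lambda>u. hop k h b a (\<lambda>u. g (c # u)) u) y"
    by (simp only: rop_diag rop_smult)
  also have "\<dots> = hop k h b a (rop d s (Suc i) g) x"
    using Suc.IH[OF x(2)] by (simp add: x rop_0 if_distrib)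
  finally show ?case by (simp add: x)
qed

lemma commute_of_operators:
  assumes X: "X \<in> Endo n l" and Y: "Y \<in> Endo n l"
    and FX: "\<And>g x. x \<in> Tidx n l \<Longrightarrow> (\<Sum>z\<in>Tidx n l. X x z * g z) = F g x"
    and FY: "\<And>g x. x \<in> Tidx n l \<Longrightarrow> (\<Sum>z\<in>Tidx n l. Y x z * g z) = H g x"
    and comm: "\<And>g x. x \<in> Tidx n l \<Longrightarrow> F (H g) x = H (F g) x"
  shows "mmult n l X Y = mmult n l Y X"
proof (rule Endo_eqI[OF mmult_Endo[OF X Y] mmult_Endo[OF Y X]])
  fix x y assume xy: "x \<in> Tidx n l" "y \<in> Tidx n l"
  \<comment> \<open>Applying a matrix to this indicator function gives its column \<open>y\<close>,
    so operators that commute on functions come from matrices that commute.\<close>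
  let ?d = "\<lambda>z. if z = y then 1 else 0 :: K"
  have col: "(\<Sum>w\<in>Tidx n l. A z w * ?d w) = A z y" for A :: mat and z
  proof -
    have "(\<Sum>w\<in>Tidx n l. A z w * ?d w) = (\<Sum>w\<in>Tidx n l. if w = y then A z w else 0)"
      by (intro sum.cong) auto
    then show ?thesis using xy by (simp add: finite_Tidx)
  qed
  have "mmult n l X Y x y = (\<Sum>z\<in>Tidx n l. X x z * H ?d z)"
    unfolding mmult_def by (intro sum.cong refl) (simp only: FY[symmetric] col)
  also have "\<dots> = H (F ?d) x" by (simp only: FX[OF xy(1)] comm[OF xy(1)])
  also have "\<dots> = (\<Sum>z\<in>Tidx n l. Y x z * F ?d z)" by (simp only: FY[OF xy(1)])
  also have "\<dots> = mmult n l Y X x y"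
    unfolding mmult_def by (intro sum.cong refl) (simp only: FX[symmetric] col)
  finally show "mmult n l X Y x y = mmult n l Y X x y" .
qed

lemma PsiGensE:
  assumes "Y \<in> PsiGens n eps l"
  obtains i where "Suc i < l" "Y = Psi_h n eps l (Suc i)"
proof -
  obtain i where "1 \<le> i" "i \<le> l - 1" "Y = Psi_h n eps l i"
    using assms by (auto simp: PsiGens_def)
  then show ?thesis using that[of "i - 1"] by auto
qed

lemma PsiGens_Endo: "PsiGens n eps l \<subseteq> Endo n l"
  by (auto simp: PsiGens_def Psi_h_Endo)

lemma mtr_PsiGens: "A \<in> PsiGens n eps l \<Longrightarrow> mtr A = A"
  by (auto simp: PsiGens_def mtr_Psi_h)

lemma PhiGensE:
  assumes "X \<in> PhiGens n eps l"
  obtains (diag) h where "X = tpow (dg n h) l"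
  | (e) i where "i \<in> {1..n}" "Suc i \<in> {1..n}" "X = hmat n (kinvf eps i) (\<lambda>_. 1) i (Suc i) l"
  | (f) i where "i \<in> {1..n}" "Suc i \<in> {1..n}" "X = hmat n (\<lambda>_. 1) (kf eps i) (Suc i) i l"
proof -
  from assms consider (d) h where "X = tpow (dg n h) l"
  | (e') i where "i \<in> {1..n - 1}" "X = Phi_e n eps i l"
  | (f') i where "i \<in> {1..n - 1}" "X = Phi_f n eps i l"
    by (auto simp: PhiGens_def omegaV_dg omegainvV_dg)
  then show ?thesis
  proof cases
    case d
    then show ?thesis by (rule diag)
  next
    case (e' i)
    then show ?thesis by (intro e[of i]) (auto simp: Phi_e_hmat)
  next
    case (f' i)
    then show ?thesis by (intro f[of i]) (auto simp: Phi_f_hmat)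
  qed
qed

lemma PhiGens_Endo: "PhiGens n eps l \<subseteq> Endo n l"
  by (auto elim!: PhiGensE simp: hmat_Endo tpow_dg_Endo)

text \<open>For e_j and f_j the nontrivial two-letter identities come down to q_j - q_j^{-1} = q -
  q^{-1}, valid for q_j = q and for q_j = -q^{-1}.\<close>

lemma PhiGens_commutant: "PhiGens n eps l \<subseteq> commutant n l (PsiGens n eps l)"
proof
  fix X assume X: "X \<in> PhiGens n eps l"
  have "mmult n l X Y = mmult n l Y X" if "Y \<in> PsiGens n eps l" for Y
    using that
  proof (rule PsiGensE)
    fix i assume i: "Suc i < l" and Y: "Y = Psi_h n eps l (Suc i)"
    have len: "Suc i < length x" if "x \<in> Tidx n l" for x
      using that i by (simp add: Tidx_def)
    note ops = Psi_h_sum[OF i]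
    from X show ?thesis
    proof (cases rule: PhiGensE)
      case (diag h)
      show ?thesis unfolding Y diag
        by (rule commute_of_operators[OF tpow_dg_Endo Psi_h_Endo tpow_dg_sum ops]) (simp_all add: rop_diag)
    next
      case (e j)
      show ?thesis unfolding Y e(3)
      proof (rule commute_of_operators[OF hmat_Endo Psi_h_Endo hmat_sum ops])
        show "hop (kinvf eps j) (\<lambda>_. 1) j (Suc j) (rop (dR eps) sR i g) x =
           rop (dR eps) sR i (hop (kinvf eps j) (\<lambda>_. 1) j (Suc j) g) x" if "x \<in> Tidx n l" for g x
          by (rule hop_rop_commute[OF _ len[OF that]])
             (auto simp: dR_def sR_def kinvf_def qj_def field_simps power2_eq_square)
      qed (use e in auto)
    next
      case (f j)
      show ?thesis unfolding Y f(3)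
      proof (rule commute_of_operators[OF hmat_Endo Psi_h_Endo hmat_sum ops])
        show "hop (\<lambda>_. 1) (kf eps j) (Suc j) j (rop (dR eps) sR i g) x =
           rop (dR eps) sR i (hop (\<lambda>_. 1) (kf eps j) (Suc j) j g) x" if "x \<in> Tidx n l" for g x
          by (rule hop_rop_commute[OF _ len[OF that]])
             (auto simp: dR_def sR_def kf_def qj_def field_simps power2_eq_square)
      qed (use f in auto)
    qed
  qed
  then show "X \<in> commutant n l (PsiGens n eps l)"
    using X PhiGens_Endo[of n eps l] by (auto simp: commutant_def)
qed

subsection \<open>The signed symmetric group at q = 1\<close>

lemma mset_swap_invariant:
  assumes "\<And>u a b v. f (u @ a # b # v) = f (u @ b # a # v)" "mset x = mset y"
  shows "f x = f y"
  using assms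
proof (induction x arbitrary: f y)
  case (Cons a x)
  have "a \<in> set y" using Cons.prems(2) by (metis list.set_intros(1) mset_eq_setD)
  then obtain y1 y2 where y: "y = y1 @ a # y2" by (meson split_list)
  have "f (y1 @ a # y2) = f (a # y1 @ y2)" for y1 y2
  proof (induction y1 arbitrary: y2 rule: rev_induct)
    case (snoc b ys)
    have "f ((ys @ [b]) @ a # y2) = f (ys @ a # b # y2)" using Cons.prems(1)[of ys b a y2] by simp
    then show ?case using snoc[of "b # y2"] by simp
  qed simp
  moreover have "f (a # x) = f (a # y1 @ y2)"
  proof (rule Cons.IH[of "\<lambda>u. f (a # u)"])
    show "f (a # u @ c # b # v) = f (a # u @ b # c # v)" for u c b v
      using Cons.prems(1)[of "a # u" c b v] by simp
    show "mset x = mset (y1 @ y2)" using Cons.prems(2) y by simp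
  qed
  ultimately show ?case by (simp add: y)
qed simp

lemma hop_replicate:
  "hop k (\<lambda>_. 1) b a g (replicate m b) =
    (\<Sum>p<m. k b ^ p * g (replicate p b @ a # replicate (m - Suc p) b))"
proof (induction m arbitrary: g)
  case (Suc m)
  have "hop k (\<lambda>_. 1) b a g (replicate (Suc m) b)
    = g (a # replicate m b) + k b * (\<Sum>p<m. k b ^ p * g (b # replicate p b @ a # replicate (m - Suc p) b))"
    by (simp add: Suc)
  also have "\<dots> = (\<Sum>p<Suc m. k b ^ p * g (replicate p b @ a # replicate (Suc m - Suc p) b))"
    unfolding sum.lessThan_Suc_shift by (simp add: sum_distrib_left mult.assoc)
  finally show ?case .
qed simp

text \<open>All pairs \<open>(b, b)\<close> are gathered next to one mismatch, so a letter
  \<open>b\<close> occurring as first component in the rest belongs to a mismatched pair.\<close>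

lemma mset_pick:
  assumes "(a, b) \<in> set z" "a \<noteq> b"
  obtains m r where "mset z = mset ((a, b) # replicate m (b, b) @ r)" "(b, b) \<notin> set r"
proof
  let ?z = "remove1 (a, b) z"
  have "mset ?z = {#p \<in># mset ?z. p = (b, b)#} + {#p \<in># mset ?z. p \<noteq> (b, b)#}"
    by (rule multiset_partition)
  then have "mset ?z = replicate_mset (count (mset ?z) (b, b)) (b, b) + mset (filter (\<lambda>p. p \<noteq> (b, b)) ?z)"
    by (simp add: filter_eq_replicate_mset del: mset_remove1)
  then have "mset ?z = mset (replicate (count (mset ?z) (b, b)) (b, b) @ filter (\<lambda>p. p \<noteq> (b, b)) ?z)"
    by (simp del: mset_remove1)
  moreover have "mset z = add_mset (a, b) (mset ?z)" using assms(1) by simp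
  ultimately show "mset z = mset ((a, b) # replicate (count (mset ?z) (b, b)) (b, b) @ filter (\<lambda>p. p \<noteq> (b, b)) ?z)"
    by (simp only: mset.simps)
  show "(b, b) \<notin> set (filter (\<lambda>p. p \<noteq> (b, b)) ?z)" by simp
qed

lemma Tidx_update: "x \<in> Tidx n l \<Longrightarrow> a \<in> {1..n} \<Longrightarrow> x[j := a] \<in> Tidx n l"
  unfolding Tidx_def using set_update_subset_insert[of x j a] by auto

text \<open>Write an entry of \<open>M\<close> as a list of letter pairs and induct on the number of pairs with
  distinct letters.  If \<open>M\<close> does not vanish at \<open>(a,b)(b,b)\<^sup>m r\<close>, where \<open>r\<close> has no pair \<open>(b,b)\<close>,
  then the ladder operator turning \<open>b\<close> into \<open>a\<close> sends \<open>M\<close> to a matrix whose entry at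
  \<open>(b,b)(b,b)\<^sup>m r\<close> is \<open>m + 1\<close> times the original one: the other contributions have fewer
  distinct pairs, and all signs cancel.\<close>
lemma ladder_closed_eq_0:
  fixes W :: "(nat list \<Rightarrow> nat list \<Rightarrow> rat) set" and t :: "nat \<Rightarrow> nat \<Rightarrow> rat"
  assumes t: "\<And>a b. a \<noteq> b \<Longrightarrow> t a b = 1" "\<And>a b. t a b * t a b = 1"
    and swap: "\<And>M u a b v u' c d v'. M \<in> W \<Longrightarrow> length u = length u' \<Longrightarrow>
        u @ a # b # v \<in> Tidx n l \<Longrightarrow> u' @ c # d # v' \<in> Tidx n l \<Longrightarrow>
        M (u @ a # b # v) (u' @ c # d # v') = t a b * t c d * M (u @ b # a # v) (u' @ d # c # v')"
    and ladder: "\<And>M a b. M \<in> W \<Longrightarrow> a \<noteq> b \<Longrightarrow> a \<in> {1..n} \<Longrightarrow> b \<in> {1..n} \<Longrightarrow>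
        (\<lambda>x y. hop (\<lambda>c. t b c * t a c) (\<lambda>_. 1) b a (\<lambda>u. M u y) x) \<in> W"
    and trace: "\<And>M x. M \<in> W \<Longrightarrow> x \<in> Tidx n l \<Longrightarrow> (\<Sum>y | mset y = mset x. M y y) = 0"
    and M: "M \<in> W" and xy: "x \<in> Tidx n l" "y \<in> Tidx n l"
  shows "M x y = 0"
proof -
  define P where "P z \<longleftrightarrow> map fst z \<in> Tidx n l \<and> map snd z \<in> Tidx n l" for z
  define mm where "mm z = length (filter (\<lambda>(a, b). a \<noteq> b) z)" for z :: "(nat \<times> nat) list"
  have t0: "t a b \<noteq> 0" for a b using t(2)[of a b] by auto
  have P_mset: "P z = P z'" if "mset z = mset z'" for z z'
  proof -
    have "mset (map fst z) = mset (map fst z')" "mset (map snd z) = mset (map snd z')"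
      using that by simp_all
    then show ?thesis unfolding P_def by (metis Tidx_mset)
  qed
  \<comment> \<open>Rearranging the pairs changes an entry by signs only. Tracking non-vanishing
    instead of the value makes these signs irrelevant.\<close>
  have nz: "M (map fst z') (map snd z') \<noteq> 0"
    if "M \<in> W" "P z" "mset z = mset z'" "M (map fst z) (map snd z) \<noteq> 0" for M z z'
  proof -
    define f where "f z \<longleftrightarrow> P z \<and> M (map fst z) (map snd z) \<noteq> 0" for z
    have "f z = f z'"
    proof (rule mset_swap_invariant)
      show "f (u @ p # q # v) = f (u @ q # p # v)" for u p q v
      proof -
        have "P (u @ p # q # v) = P (u @ q # p # v)" by (rule P_mset) simp
        moreover have "M (map fst (u @ p # q # v)) (map snd (u @ p # q # v)) = t (fst p) (fst q) * t (snd p) (snd q) *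
            M (map fst (u @ q # p # v)) (map snd (u @ q # p # v))" if "P (u @ p # q # v)"
          using swap[OF \<open>M \<in> W\<close>, of "map fst u" "map snd u" "fst p" "fst q" "map fst v" "snd p" "snd q" "map snd v"] that
          by (simp add: P_def)
        ultimately show ?thesis unfolding f_def using t0 by auto
      qed
    qed (fact that(3))
    then show ?thesis using that by (simp add: f_def)
  qed
  have "M (map fst z) (map snd z) = 0" if "M \<in> W" "P z" for M z
    using that
  proof (induction "mm z" arbitrary: M z rule: less_induct)
    case less
    show ?case
    proof (rule ccontr)
      assume Mz: "M (map fst z) (map snd z) \<noteq> 0"
      show False
      proof (cases "\<forall>(a, b)\<in>set z. a = b")
        case True
        then have eq: "map snd z = map fst z" by auto
        let ?x = "map fst z" and ?Y = "{y. mset y = mset (map fst z)}"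
        have x: "?x \<in> Tidx n l" using less.prems(2) by (simp add: P_def)
        have fin: "finite ?Y"
          by (rule finite_subset[OF _ finite_Tidx[of n l]]) (auto intro: Tidx_mset[OF x])
        \<comment> \<open>On the diagonal both signs of a swap agree and multiply to 1, so diagonal
          entries are constant on a weight. The default 0 extends this invariance to words outside
          \<open>Tidx n l\<close>.\<close>
        define g where "g w = (if w \<in> Tidx n l then M w w else 0)" for w
        have g: "g w = g ?x" if "mset w = mset ?x" for w
        proof (rule mset_swap_invariant[OF _ that])
          show "g (u @ a # b # v) = g (u @ b # a # v)" for u a b v
          proof -
            have "u @ a # b # v \<in> Tidx n l \<longleftrightarrow> u @ b # a # v \<in> Tidx n l"
              by (auto simp: Tidx_def)
            then show ?thesis
              using swap[OF less.prems(1), of u u a b v a b v] by (auto simp: g_def t(2))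
          qed
        qed
        have "M w w = M ?x ?x" if "w \<in> ?Y" for w
        proof -
          have "w \<in> Tidx n l" using that Tidx_mset[OF x] by blast
          moreover have "g w = g ?x" using that by (intro g) simp
          ultimately show ?thesis using x by (simp only: g_def if_True)
        qed
        then have "(\<Sum>y\<in>?Y. M y y) = (\<Sum>y\<in>?Y. M ?x ?x)" by (rule sum.cong[OF refl])
        then have "(\<Sum>y\<in>?Y. M y y) = of_nat (card ?Y) * M ?x ?x" by (simp only: sum_constant)
        then have "card ?Y = 0"
          using trace[OF less.prems(1) x] Mz eq by simp
        then have "?Y = {}" using fin by (simp only: card_0_eq)
        then show False by blast
      next
        case False
        then obtain a b where ab: "(a, b) \<in> set z" "a \<noteq> b" by auto
        obtain m r where z: "mset z = mset ((a, b) # replicate m (b, b) @ r)" and r: "(b, b) \<notin> set r"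
          using mset_pick[OF ab] .
        let ?rx = "map fst r" and ?ry = "map snd r"
        let ?y = "replicate (Suc m) b @ ?ry" and ?x' = "replicate (Suc m) b @ ?rx"
        let ?k = "\<lambda>c. t b c * t a c"
        have Pz': "P ((a, b) # replicate m (b, b) @ r)" using P_mset[OF z] less.prems(2) by simp
        then have y: "?y \<in> Tidx n l" and x: "a # replicate m b @ ?rx \<in> Tidx n l"
          by (simp_all add: P_def)
        have rng: "a \<in> {1..n}" "b \<in> {1..n}" using x y by (auto simp: Tidx_Cons)
        have Mxy: "M (a # replicate m b @ ?rx) ?y \<noteq> 0"
          using nz[OF less.prems z Mz] by simp
        have mz: "mm z = Suc (mm r)"
        proof -
          have "mm z = size (filter_mset (\<lambda>(a, b). a \<noteq> b) (mset z))" by (simp add: mm_def flip: mset_filter)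
          also have "\<dots> = mm ((a, b) # replicate m (b, b) @ r)" unfolding z by (simp add: mm_def flip: mset_filter)
          finally show ?thesis using ab(2) by (simp add: mm_def)
        qed
        define N where "N = (\<lambda>x y. hop ?k (\<lambda>_. 1) b a (\<lambda>u. M u y) x)"
        have N: "N \<in> W" unfolding N_def by (rule ladder[OF less.prems(1) ab(2) rng])
        \<comment> \<open>Here the mismatch \<open>(a, b)\<close> has become \<open>(b, b)\<close>,
          so the induction hypothesis applies to \<open>N\<close>.\<close>
        have "N (map fst (replicate (Suc m) (b, b) @ r)) (map snd (replicate (Suc m) (b, b) @ r)) = 0"
        proof (rule less.hyps[OF _ N])
          show "mm (replicate (Suc m) (b, b) @ r) < mm z" using mz by (simp add: mm_def)
          show "P (replicate (Suc m) (b, b) @ r)" using Pz' rng by (simp add: P_def Tidx_Cons)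
        qed
        then have N0: "N ?x' ?y = 0" by simp
        \<comment> \<open>Moving \<open>(a, b)\<close> past one \<open>(b, b)\<close> costs the sign
          \<open>t b b\<close>, coming from the second components alone; the ladder weight
          \<open>?k b\<close> is the same sign and cancels it.\<close>
        have *: "?k b ^ p * M (replicate p b @ a # replicate d b @ ?rx) (replicate (Suc (p + d)) b @ ?ry)
            = M (a # replicate (p + d) b @ ?rx) (replicate (Suc (p + d)) b @ ?ry)"
          if "p + d = m" for p d
          using that
        proof (induction p arbitrary: d)
          case (Suc p)
          have app: "replicate (Suc p) b @ w = replicate p b @ b # w"
            "replicate (Suc (Suc p + d)) b @ w = replicate p b @ b # b # replicate d b @ w" for w
            by (simp_all add: replicate_add replicate_app_Cons_same)
          have T: "replicate p b @ b # a # replicate d b @ ?rx \<in> Tidx n l"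
            by (rule Tidx_mset[OF x]) (simp add: Suc.prems[symmetric] replicate_add)
          have T': "replicate p b @ b # b # replicate d b @ ?ry \<in> Tidx n l"
            using y unfolding Suc.prems[symmetric] app .
          have "M (replicate (Suc p) b @ a # replicate d b @ ?rx) (replicate (Suc (Suc p + d)) b @ ?ry)
             = t b b * M (replicate p b @ a # replicate (Suc d) b @ ?rx) (replicate (Suc (p + Suc d)) b @ ?ry)"
            using swap[OF less.prems(1) _ T T'] t(1)[of b a] ab(2) unfolding app
            by (simp add: replicate_add replicate_app_Cons_same)
          moreover have "?k b = t b b" using t(1)[of a b] ab(2) by simp
          ultimately have "?k b ^ Suc p * M (replicate (Suc p) b @ a # replicate d b @ ?rx) (replicate (Suc (Suc p + d)) b @ ?ry)
             = (t b b * t b b) * (?k b ^ p * M (replicate p b @ a # replicate (Suc d) b @ ?rx) (replicate (Suc (p + Suc d)) b @ ?ry))"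
            by (simp only: power_Suc mult.assoc mult.left_commute)
          also have "\<dots> = M (a # replicate (p + Suc d) b @ ?rx) (replicate (Suc (p + Suc d)) b @ ?ry)"
            using Suc.IH[of "Suc d"] Suc.prems by (simp only: t(2) mult_1 add_Suc_shift)
          finally show ?case by simp
        qed simp
        have "hop ?k (\<lambda>_. 1) b a (\<lambda>u. M (u @ ?rx) ?y) (replicate (Suc m) b)
           = (\<Sum>p<Suc m. M (a # replicate m b @ ?rx) ?y)"
          unfolding hop_replicate
        proof (intro sum.cong refl)
          fix p assume "p \<in> {..<Suc m}"
          then have "p + (m - p) = m" by simp
          from *[OF this] this show "?k b ^ p * M ((replicate p b @ a # replicate (Suc m - Suc p) b) @ ?rx) ?y
             = M (a # replicate m b @ ?rx) ?y" by simp
        qed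
        \<comment> \<open>A letter \<open>b\<close> in \<open>r\<close> is already mismatched, so
          replacing it by \<open>a\<close> cannot increase the number of mismatches. Together the
          pairs of \<open>r\<close> have one mismatch fewer than \<open>z\<close>.\<close>
        moreover have "hop ?k (\<lambda>_. 1) b a (\<lambda>v. M (replicate (Suc m) b @ v) ?y) ?rx = 0"
        proof (rule hop_eq_0)
          fix j assume j: "j < length ?rx" "?rx ! j = b"
          let ?r = "r[j := (a, snd (r ! j))]"
          have rj: "r ! j = (b, snd (r ! j))" "snd (r ! j) \<noteq> b"
          proof -
            show 1: "r ! j = (b, snd (r ! j))" using j by (simp add: prod_eq_iff)
            have "r ! j \<in> set r" using j by simp
            then show "snd (r ! j) \<noteq> b" using r 1 by metis
          qed
          have "mm r = mm (take j r @ r ! j # drop (Suc j) r)"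
            using j by (simp flip: id_take_nth_drop)
          then have "mm ?r \<le> mm r"
            using rj j by (cases "r ! j") (simp add: upd_conv_take_nth_drop mm_def)
          then have "mm (replicate (Suc m) (b, b) @ ?r) < mm z" using mz by (simp add: mm_def)
          moreover have fs: "map fst ?r = ?rx[j := a]" "map snd ?r = ?ry"
            using j by (simp_all add: map_update list_update_same_conv)
          moreover have "P (replicate (Suc m) (b, b) @ ?r)"
          proof -
            have "(a # replicate m b @ ?rx)[0 := b, Suc m + j := a] \<in> Tidx n l"
              by (intro Tidx_update x rng)
            also have "(a # replicate m b @ ?rx)[0 := b, Suc m + j := a] = replicate (Suc m) b @ ?rx[j := a]"
              by (simp add: list_update_append)
            finally show ?thesis using y fs by (simp add: P_def)
          qed
          ultimately show "M (replicate (Suc m) b @ ?rx[j := a]) ?y = 0"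
            using less.hyps[of "replicate (Suc m) (b, b) @ ?r", OF _ less.prems(1)] by simp
        qed
        ultimately have "N ?x' ?y = of_nat (Suc m) * M (a # replicate m b @ ?rx) ?y"
          unfolding N_def hop_append by simp
        then show False using N0 Mxy by (simp del: of_nat_Suc)
      qed
    qed
  qed
  moreover have "map fst (zip x y) = x" "map snd (zip x y) = y"
    using xy by (auto simp: Tidx_def)
  ultimately show ?thesis using M xy unfolding P_def by metis
qed

subsection \<open>Weight idempotents\<close>

definition diagm :: "nat \<Rightarrow> nat \<Rightarrow> (nat list \<Rightarrow> K) \<Rightarrow> mat" where
  "diagm n l g x y = (if x = y \<and> x \<in> Tidx n l then g x else 0)"

lemma diagm_Endo: "diagm n l g \<in> Endo n l"
  by (auto simp: Endo_def diagm_def)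

lemma diagm_cong: "(\<And>x. x \<in> Tidx n l \<Longrightarrow> f x = g x) \<Longrightarrow> diagm n l f = diagm n l g"
  by (auto simp: diagm_def fun_eq_iff)

lemma mmult_diagm: "x \<in> Tidx n l \<Longrightarrow> mmult n l (diagm n l f) M x y = f x * M x y"
proof -
  assume x: "x \<in> Tidx n l"
  have "mmult n l (diagm n l f) M x y = (\<Sum>z\<in>Tidx n l. if x = z then f x * M x y else 0)"
    unfolding mmult_def by (intro sum.cong) (auto simp: diagm_def)
  then show ?thesis using x by (simp add: finite_Tidx)
qed

lemma diagm_mult: "diagm n l (\<lambda>x. f x * g x) = mmult n l (diagm n l f) (diagm n l g)"
  by (rule Endo_eqI[OF diagm_Endo mmult_Endo[OF diagm_Endo diagm_Endo]])
     (simp add: mmult_diagm, simp add: diagm_def)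

lemma diagm_alg_gen_mult:
  "diagm n l f \<in> alg_gen n l S \<Longrightarrow> diagm n l g \<in> alg_gen n l S \<Longrightarrow>
     diagm n l (\<lambda>x. f x * g x) \<in> alg_gen n l S"
  unfolding diagm_mult by (rule alg_gen.mult)

lemma diagm_alg_gen_const: "diagm n l (\<lambda>x. c) \<in> alg_gen n l S"
proof -
  have "diagm n l (\<lambda>x. c) = (\<lambda>x y. c * mid n l x y)"
    by (auto simp: diagm_def mid_def fun_eq_iff)
  then show ?thesis using alg_gen.smult[OF alg_gen.one] by simp
qed

lemma diagm_alg_gen_add:
  assumes "diagm n l f \<in> alg_gen n l S" "diagm n l g \<in> alg_gen n l S"
  shows "diagm n l (\<lambda>x. f x + g x) \<in> alg_gen n l S"
proof -
  have "diagm n l (\<lambda>x. f x + g x) = (\<lambda>x y. diagm n l f x y + diagm n l g x y)"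
    by (auto simp: diagm_def fun_eq_iff)
  then show ?thesis using alg_gen.add[OF assms] by simp
qed

lemma diagm_alg_gen_prod:
  "finite I \<Longrightarrow> (\<And>i. i \<in> I \<Longrightarrow> diagm n l (f i) \<in> alg_gen n l S) \<Longrightarrow>
     diagm n l (\<lambda>x. \<Prod>i\<in>I. f i x) \<in> alg_gen n l S"
  by (induction I rule: finite_induct) (auto intro: diagm_alg_gen_const diagm_alg_gen_mult)

lemma omega_diagm: "tpow (omegaV n eps j) l = diagm n l (\<lambda>x. qj eps j ^ count (mset x) j)"
proof -
  have "prod_list (map (\<lambda>a. if a = j then qj eps j else 1) x) = qj eps j ^ count (mset x) j" for x
    by (induction x) auto
  then show ?thesis by (simp add: omegaV_dg tpow_dg diagm_def fun_eq_iff)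
qed

lemma omega_PhiImage: "j \<in> {1..n} \<Longrightarrow> tpow (omegaV n eps j) l \<in> PhiImage n eps l"
  unfolding PhiImage_def by (rule alg_gen.gen) (auto simp: PhiGens_def)

text \<open>Lagrange interpolation in the eigenvalues of the \<open>\<omega>\<^sub>j\<close>.\<close>
lemma weight_idempotent:
  "diagm n l (\<lambda>u. if mset u = mset x then 1 else 0) \<in> PhiImage n eps l"
proof -
  let ?q = "qj eps" and ?c = "\<lambda>u j. count (mset u) j"
  \<comment> \<open>The nodes are the exponents up to \<open>l\<close>, since no letter occurs more
    often in a word of length \<open>l\<close>.\<close>
  define L where "L j u = (\<Prod>m\<in>{..l} - {?c x j}. (?q j ^ ?c u j + - (?q j ^ m)) * inverse (?q j ^ ?c x j - ?q j ^ m))" for j u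
  have L: "diagm n l (L j) \<in> PhiImage n eps l" if "j \<in> {1..n}" for j
    unfolding L_def PhiImage_def
    using omega_PhiImage[OF that, of eps l]
    by (intro diagm_alg_gen_prod diagm_alg_gen_mult diagm_alg_gen_add diagm_alg_gen_const)
       (simp_all add: omega_diagm PhiImage_def)
  have Lval: "L j u = (if ?c u j = ?c x j then 1 else 0)" if "u \<in> Tidx n l" for j u
  proof -
    have le: "?c u j \<le> l"
      using that count_le_size[of "mset u" j] by (simp add: Tidx_def)
    show ?thesis
    proof (cases "?c u j = ?c x j")
      case True
      then show ?thesis unfolding L_def by (auto intro!: prod.neutral simp: qj_power_inject)
    next
      case False
      then have "L j u = 0"
        unfolding L_def using le by (intro prod_zero) (auto intro!: bexI[of _ "?c u j"])
      then show ?thesis using False by simp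
    qed
  qed
  have "diagm n l (\<lambda>u. if mset u = mset x then 1 else 0) \<in> PhiImage n eps l" if "x \<in> Tidx n l"
  proof -
    have "diagm n l (\<lambda>u. \<Prod>j\<in>{1..n}. L j u) \<in> PhiImage n eps l"
      using L unfolding PhiImage_def by (intro diagm_alg_gen_prod) auto
    also have "diagm n l (\<lambda>u. \<Prod>j\<in>{1..n}. L j u) = diagm n l (\<lambda>u. if mset u = mset x then 1 else 0)"
    proof (rule diagm_cong)
      fix u assume u: "u \<in> Tidx n l"
      have "mset u = mset x" if "\<forall>j\<in>{1..n}. ?c u j = ?c x j"
      proof (rule multiset_eqI)
        fix j
        show "?c u j = ?c x j"
        proof (cases "j \<in> {1..n}")
          case False
          then have "j \<notin> set u" "j \<notin> set x" using u \<open>x \<in> Tidx n l\<close> by (auto simp: Tidx_def)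
          then have "?c u j = 0" "?c x j = 0" unfolding count_eq_zero_iff by simp_all
          then show ?thesis by (simp only:)
        qed (use that in blast)
      qed
      then have "(\<forall>j\<in>{1..n}. ?c u j = ?c x j) \<longleftrightarrow> mset u = mset x" by auto
      moreover have "(\<Prod>j\<in>{1..n}. L j u) = (if \<forall>j\<in>{1..n}. ?c u j = ?c x j then 1 else 0)"
        by (auto simp: Lval[OF u] intro!: prod.neutral prod_zero)
      ultimately show "(\<Prod>j\<in>{1..n}. L j u) = (if mset u = mset x then 1 else 0)" by simp
    qed
    finally show ?thesis .
  qed
  moreover have "diagm n l (\<lambda>u. if mset u = mset x then 1 else 0) = diagm n l (\<lambda>u. 0)" if "x \<notin> Tidx n l"
  proof (rule diagm_cong)
    fix u assume "u \<in> Tidx n l"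
    then have "mset u \<noteq> mset x" using that Tidx_mset by metis
    then show "(if mset u = mset x then 1 else 0) = (0 :: K)" by simp
  qed
  ultimately show ?thesis
    using diagm_alg_gen_const[of n l 0] unfolding PhiImage_def by metis
qed

subsection \<open>The orthogonal complement of the image of the quantum group\<close>

text \<open>The diagonal values are those of \<open>q\<^sub>j\<close> at \<open>q = 1\<close>.\<close>
definition sgnc :: "(nat \<Rightarrow> nat) \<Rightarrow> nat \<Rightarrow> nat \<Rightarrow> rat" where
  "sgnc eps a b = (if a = b \<and> eps a \<noteq> 0 then - 1 else 1)"

lemma sgnc_simps: "a \<noteq> b \<Longrightarrow> sgnc eps a b = 1" "sgnc eps a b * sgnc eps a b = 1"
  "sgnc eps a b = sgnc eps b a"
  by (auto simp: sgnc_def)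

lemma at1_qj: "at1 (qj eps j) (sgnc eps j j)" "at1 (inverse (qj eps j)) (sgnc eps j j)"
  by (auto simp: qj_def sgnc_def inverse_minus_eq at1_qq at1_inverse_qq intro: at1_minus)

lemma at1_kinvf: "at1 (kinvf eps i c) (sgnc eps (Suc i) c * sgnc eps i c)"
  using at1_qj[of eps i] at1_qj[of eps "Suc i"] at1_1 by (auto simp: kinvf_def sgnc_simps)

lemma at1_kf: "at1 (kf eps i c) (sgnc eps i c * sgnc eps (Suc i) c)"
  using at1_qj[of eps i] at1_qj[of eps "Suc i"] at1_1 by (auto simp: kf_def sgnc_simps)

lemma at1_dR: "at1 (dR eps a b) (if a = b then sgnc eps a a else 0)"
proof -
  have "at1 (inverse qq * inverse (qj eps a)) (1 * sgnc eps a a)"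
    by (intro at1_mult at1_inverse_qq at1_qj)
  moreover have "at1 (inverse qq ^ 2 - 1) (1 * 1 - 1)"
    unfolding power2_eq_square by (intro at1_diff at1_mult at1_inverse_qq at1_1)
  ultimately show ?thesis by (cases "a = b") (simp_all add: dR_def at1_0)
qed

lemma at1_sR: "at1 (sR a b) (if a = b then 0 else 1)"
  by (simp add: sR_def at1_0 at1_inverse_qq)

lemma at1_const: "at1 (Fract [:r:] 1) r"
  unfolding at1_def by (intro exI[of _ "[:r:]"] exI[of _ 1]) simp

definition PhiOrth :: "nat \<Rightarrow> (nat \<Rightarrow> nat) \<Rightarrow> nat \<Rightarrow> mat set" where
  "PhiOrth n eps l = {M \<in> commutant n l (PsiGens n eps l). \<forall>A\<in>PhiImage n eps l. mip n l M A = 0}"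

text \<open>The residues at q = 1 of those elements of \<open>PhiOrth\<close> that are regular
  there. Values at words outside \<open>Tidx n l\<close> are left free.\<close>

definition PhiOrth1 :: "nat \<Rightarrow> (nat \<Rightarrow> nat) \<Rightarrow> nat \<Rightarrow> (nat list \<Rightarrow> nat list \<Rightarrow> rat) set" where
  "PhiOrth1 n eps l = {g. \<exists>M\<in>PhiOrth n eps l. \<forall>x\<in>Tidx n l. \<forall>y\<in>Tidx n l. at1 (M x y) (g x y)}"

lemma PhiImage_commutant: "PhiImage n eps l \<subseteq> commutant n l (PsiGens n eps l)"
  unfolding PhiImage_def by (rule alg_gen_subset_commutant[OF PsiGens_Endo PhiGens_commutant])

lemma PhiOrth_lincomb:
  "A \<in> PhiOrth n eps l \<Longrightarrow> B \<in> PhiOrth n eps l \<Longrightarrow> (\<lambda>x y. A x y + c * B x y) \<in> PhiOrth n eps l"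
  by (auto simp: PhiOrth_def mip_add_left mip_smult_left intro: add_commutant smult_commutant)

text \<open>By adjointness the pairing of A^T M with C is that of M with A C, and A C stays in the
  image. The transpose still commutes with the Hecke generators because these are symmetric.\<close>

lemma PhiOrth_mult:
  assumes M: "M \<in> PhiOrth n eps l" and A: "A \<in> PhiImage n eps l"
  shows "mmult n l (mtr A) M \<in> PhiOrth n eps l"
proof -
  have "mip n l (mmult n l (mtr A) M) C = 0" if "C \<in> PhiImage n eps l" for C
  proof -
    have "mmult n l A C \<in> PhiImage n eps l" using A that unfolding PhiImage_def by (rule alg_gen.mult)
    then show ?thesis using M by (simp add: mip_mmult_left PhiOrth_def)
  qed
  moreover have "mtr A \<in> commutant n l (PsiGens n eps l)"
    using A PhiImage_commutant by (intro mtr_commutant mtr_PsiGens) auto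
  ultimately show ?thesis using M by (auto simp: PhiOrth_def intro: mmult_commutant)
qed

lemma PhiOrth1_lincomb:
  assumes "f \<in> PhiOrth1 n eps l" "g \<in> PhiOrth1 n eps l"
  shows "(\<lambda>x y. f x y + r * g x y) \<in> PhiOrth1 n eps l"
proof -
  obtain A B where A: "A \<in> PhiOrth n eps l" "\<And>x y. x \<in> Tidx n l \<Longrightarrow> y \<in> Tidx n l \<Longrightarrow> at1 (A x y) (f x y)"
    and B: "B \<in> PhiOrth n eps l" "\<And>x y. x \<in> Tidx n l \<Longrightarrow> y \<in> Tidx n l \<Longrightarrow> at1 (B x y) (g x y)"
    using assms unfolding PhiOrth1_def by blast
  show ?thesis
    unfolding PhiOrth1_def mem_Collect_eq
    by (intro bexI[OF _ PhiOrth_lincomb[OF A(1) B(1), of "Fract [:r:] 1"]] ballI at1_add at1_mult at1_const A B)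
qed

lemma PhiOrth1_smult: "f \<in> PhiOrth1 n eps l \<Longrightarrow> (\<lambda>x y. r * f x y) \<in> PhiOrth1 n eps l"
  using PhiOrth1_lincomb[of f n eps l f "r - 1"] by (simp add: algebra_simps)

lemma PhiOrth1_diag:
  assumes "f \<in> PhiOrth1 n eps l" "j \<in> {1..n}"
  shows "(\<lambda>x y. sgnc eps j j ^ count (mset x) j * f x y) \<in> PhiOrth1 n eps l"
proof -
  obtain A where A: "A \<in> PhiOrth n eps l" "\<And>x y. x \<in> Tidx n l \<Longrightarrow> y \<in> Tidx n l \<Longrightarrow> at1 (A x y) (f x y)"
    using assms unfolding PhiOrth1_def by blast
  have p: "at1 (qj eps j ^ m) (sgnc eps j j ^ m)" for m
    by (induction m) (auto intro: at1_mult at1_1 at1_qj)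
  let ?D = "tpow (omegaV n eps j) l"
  have D: "mtr ?D = diagm n l (\<lambda>x. qj eps j ^ count (mset x) j)"
    by (auto simp: omega_diagm mtr_def diagm_def fun_eq_iff)
  show ?thesis unfolding PhiOrth1_def mem_Collect_eq
    using PhiOrth_mult[OF A(1) omega_PhiImage[OF assms(2)]] unfolding D
    by (rule bexI[rotated]) (auto simp: mmult_diagm intro!: at1_mult p A(2))
qed

section \<open>Letter-replacing operators on the specialisations\<close>

definition lad :: "(nat \<Rightarrow> nat) \<Rightarrow> nat \<Rightarrow> nat \<Rightarrow> (nat list \<Rightarrow> nat list \<Rightarrow> rat) \<Rightarrow> nat list \<Rightarrow> nat list \<Rightarrow> rat" where
  "lad eps b a M = (\<lambda>x y. hop (\<lambda>c. sgnc eps b c * sgnc eps a c) (\<lambda>_. 1) b a (\<lambda>u. M u y) x)"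

lemma PhiOrth1_hop:
  assumes "f \<in> PhiOrth1 n eps l" "hmat n k h a b l \<in> PhiImage n eps l" "a \<in> {1..n}" "b \<in> {1..n}"
    "\<And>c. at1 (k c) (k' c)" "\<And>c. at1 (h c) (h' c)"
  shows "(\<lambda>x y. hop k' h' b a (\<lambda>u. f u y) x) \<in> PhiOrth1 n eps l"
proof -
  obtain A where A: "A \<in> PhiOrth n eps l" "\<And>x y. x \<in> Tidx n l \<Longrightarrow> y \<in> Tidx n l \<Longrightarrow> at1 (A x y) (f x y)"
    using assms unfolding PhiOrth1_def by blast
  show ?thesis unfolding PhiOrth1_def mem_Collect_eq
    using PhiOrth_mult[OF A(1) assms(2)] unfolding mtr_hmat
  proof (rule bexI[rotated], intro ballI)
    fix x y assume xy: "x \<in> Tidx n l" "y \<in> Tidx n l"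
    have "mmult n l (hmat n k h b a l) A x y = hop k h b a (\<lambda>u. A u y) x"
      unfolding mmult_def by (rule hmat_sum[OF assms(3,4) xy(1)])
    then show "at1 (mmult n l (hmat n k h b a l) A x y) (hop k' h' b a (\<lambda>u. f u y) x)"
      using at1_hop[OF xy(1) assms(3,5,6), where g="\<lambda>u. A u y" and g'="\<lambda>u. f u y" and b=b] A(2) xy(2) by simp
  qed
qed

text \<open>This is the transpose of e_i at q = 1; its weights already stand on the left.\<close>

lemma lad_down:
  assumes f: "f \<in> PhiOrth1 n eps l" and i: "i \<in> {1..n}" "Suc i \<in> {1..n}"
  shows "lad eps (Suc i) i f \<in> PhiOrth1 n eps l"
proof -
  have "hmat n (kinvf eps i) (\<lambda>_. 1) i (Suc i) l \<in> PhiImage n eps l"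
    unfolding Phi_e_hmat[symmetric] PhiImage_def using i by (intro alg_gen.gen) (auto simp: PhiGens_def)
  then show ?thesis unfolding lad_def by (rule PhiOrth1_hop[OF f _ i at1_kinvf at1_1])
qed

text \<open>The transpose of f_i has its weights on the right. At q = 1 they are signs, and the
  actions of \<omega>_i and \<omega>_{i+1} move them to the left.\<close>

lemma lad_up:
  assumes f: "f \<in> PhiOrth1 n eps l" and i: "i \<in> {1..n}" "Suc i \<in> {1..n}"
  shows "lad eps i (Suc i) f \<in> PhiOrth1 n eps l"
proof -
  let ?k = "\<lambda>c. sgnc eps i c * sgnc eps (Suc i) c"
  have "hmat n (\<lambda>_. 1) (kf eps i) (Suc i) i l \<in> PhiImage n eps l"
    unfolding Phi_f_hmat[symmetric] PhiImage_def using i by (intro alg_gen.gen) (auto simp: PhiGens_def)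
  then have "(\<lambda>x y. hop (\<lambda>_. 1) ?k i (Suc i) (\<lambda>u. f u y) x) \<in> PhiOrth1 n eps l" (is "?g \<in> _")
    by (rule PhiOrth1_hop[OF f _ i(2,1) at1_1 at1_kf])
  then have "(\<lambda>x y. ?k i * (sgnc eps i i ^ count (mset x) i *
      (sgnc eps (Suc i) (Suc i) ^ count (mset x) (Suc i) * ?g x y))) \<in> PhiOrth1 n eps l"
    by (intro PhiOrth1_smult PhiOrth1_diag i)
  moreover have "prod_list (map ?k x) = sgnc eps i i ^ count (mset x) i * sgnc eps (Suc i) (Suc i) ^ count (mset x) (Suc i)" for x
    by (induction x) (auto simp: sgnc_def)
  moreover have "?k c * ?k c = 1" for c by (simp add: sgnc_def)
  ultimately show ?thesis unfolding lad_def by (simp add: hop_suffix_prefix mult.assoc)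
qed

lemma lad_compose:
  assumes "a \<noteq> b" "b \<noteq> c" "a \<noteq> c"
    and ba: "\<And>f. f \<in> PhiOrth1 n eps l \<Longrightarrow> lad eps b a f \<in> PhiOrth1 n eps l"
    and ac: "\<And>f. f \<in> PhiOrth1 n eps l \<Longrightarrow> lad eps a c f \<in> PhiOrth1 n eps l"
    and f: "f \<in> PhiOrth1 n eps l"
  shows "lad eps b c f \<in> PhiOrth1 n eps l"
proof -
  have "lad eps b c f = (\<lambda>x y. lad eps b a (lad eps a c f) x y + (- sgnc eps a a) * lad eps a c (lad eps b a f) x y)"
    unfolding lad_def
    by (intro ext, subst hop_commutator[OF sgnc_simps(1,2) assms(1-3), symmetric]) simp_all
  then show ?thesis by (simp only: PhiOrth1_lincomb[OF ba[OF ac[OF f]] ac[OF ba[OF f]]])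
qed

text \<open>The generators give only neighbouring letters. Induction on the distance composes
  through the letter next to the larger one by colour commutators.\<close>

lemma lad_PhiOrth1:
  assumes "f \<in> PhiOrth1 n eps l" "a \<noteq> b" "a \<in> {1..n}" "b \<in> {1..n}"
  shows "lad eps b a f \<in> PhiOrth1 n eps l"
proof -
  have "(\<forall>f\<in>PhiOrth1 n eps l. lad eps i (i + Suc d) f \<in> PhiOrth1 n eps l) \<and>
        (\<forall>f\<in>PhiOrth1 n eps l. lad eps (i + Suc d) i f \<in> PhiOrth1 n eps l)"
    if "i \<in> {1..n}" "i + Suc d \<in> {1..n}" for i d
    using that
  proof (induction d)
    case 0
    then show ?case by (auto intro: lad_up lad_down)
  next
    case (Suc d)
    let ?m = "i + Suc d"
    have m: "?m \<in> {1..n}" "Suc ?m \<in> {1..n}" using Suc.prems by auto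
    have "lad eps i (Suc ?m) f \<in> PhiOrth1 n eps l" if "f \<in> PhiOrth1 n eps l" for f
    proof (rule lad_compose[of ?m])
      show "lad eps i ?m g \<in> PhiOrth1 n eps l" if "g \<in> PhiOrth1 n eps l" for g
        using Suc.IH[OF Suc.prems(1) m(1)] that by blast
    qed (use that lad_up[OF _ m] in auto)
    moreover have "lad eps (Suc ?m) i f \<in> PhiOrth1 n eps l" if "f \<in> PhiOrth1 n eps l" for f
    proof (rule lad_compose[of ?m])
      show "lad eps ?m i g \<in> PhiOrth1 n eps l" if "g \<in> PhiOrth1 n eps l" for g
        using Suc.IH[OF Suc.prems(1) m(1)] that by blast
    qed (use that lad_down[OF _ m] in auto)
    ultimately show ?case by simp
  qed
  note this[of a "b - a - 1"] this[of b "a - b - 1"]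
  then show ?thesis using assms by (cases "a < b") auto
qed

lemma rop_at:
  "rop d s (length u) g (u @ a # b # v) = d a b * g (u @ a # b # v) + s a b * g (u @ b # a # v)"
  by (induction u arbitrary: g) auto

text \<open>At q = 1 the matrix of h_i is the signed exchange of two letters. Commuting with it
  equates an exchange in the row index with one in the column index.\<close>

lemma PhiOrth1_swap:
  assumes f: "f \<in> PhiOrth1 n eps l" and len: "length u = length u'"
    and x: "u @ a # b # v \<in> Tidx n l" and y: "u' @ c # d # v' \<in> Tidx n l"
  shows "f (u @ a # b # v) (u' @ c # d # v')
    = sgnc eps a b * sgnc eps c d * f (u @ b # a # v) (u' @ d # c # v')"
proof -
  obtain M where M: "M \<in> PhiOrth n eps l" "\<And>x y. x \<in> Tidx n l \<Longrightarrow> y \<in> Tidx n l \<Longrightarrow> at1 (M x y) (f x y)"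
    using f unfolding PhiOrth1_def by blast
  let ?i = "length u" and ?d = "\<lambda>a b. if a = b then sgnc eps a a else 0" and ?s = "\<lambda>a b. if a = b then 0 else 1 :: rat"
  have i: "Suc ?i < l" using x by (simp add: Tidx_def)
  let ?P = "Psi_h n eps l (Suc ?i)"
  have "?P \<in> PsiGens n eps l" using i by (auto simp: PsiGens_def)
  then have comm: "mmult n l M ?P = mmult n l ?P M" using M(1) by (simp add: PhiOrth_def commutant_def)
  have "rop ?d ?s ?i (\<lambda>z. f z y) x = rop ?d ?s ?i (\<lambda>z. f x z) y" if xy: "x \<in> Tidx n l" "y \<in> Tidx n l" for x y
  proof -
    have "rop (dR eps) sR ?i (\<lambda>z. M z y) x = mmult n l ?P M x y"
      unfolding mmult_def by (rule Psi_h_sum[OF i xy(1), symmetric])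
    also have "\<dots> = mmult n l M ?P x y" by (simp add: comm)
    \<comment> \<open>After transposing, the symmetric matrix \<open>?P\<close> acts on the column
      index by the same operator.\<close>
    also have "\<dots> = mmult n l (mtr ?P) (mtr M) y x"
      unfolding mtr_mmult[symmetric] by (simp add: mtr_def)
    also have "\<dots> = rop (dR eps) sR ?i (\<lambda>z. M x z) y"
      unfolding mtr_Psi_h mmult_def using Psi_h_sum[OF i xy(2)] by (simp add: mtr_def)
    finally have eq: "rop (dR eps) sR ?i (\<lambda>z. M z y) x = rop (dR eps) sR ?i (\<lambda>z. M x z) y" .
    have "at1 (rop (dR eps) sR ?i (\<lambda>z. M z y) x) (rop ?d ?s ?i (\<lambda>z. f z y) x)"
      "at1 (rop (dR eps) sR ?i (\<lambda>z. M x z) y) (rop ?d ?s ?i (\<lambda>z. f x z) y)"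
      by (rule at1_rop[OF xy(1) at1_dR at1_sR], simp add: M(2) xy)
         (rule at1_rop[OF xy(2) at1_dR at1_sR], simp add: M(2) xy)
    then show ?thesis unfolding eq by (rule at1_unique)
  qed
  \<comment> \<open>The column word is taken with \<open>c\<close> and \<open>d\<close> already
    exchanged, so that each side involves one exchange.\<close>
  note rel = this[of "u @ a # b # v" "u' @ d # c # v'"]
  have d: "?d a b * p (u @ a # b # v) + ?s a b * p (u @ b # a # v) = sgnc eps a b * p (u @ b # a # v)"
    for u v a b and p :: "nat list \<Rightarrow> rat"
    by (auto simp: sgnc_simps)
  have y': "u' @ d # c # v' \<in> Tidx n l" using y by (rule Tidx_mset) simp
  have "sgnc eps a b * f (u @ b # a # v) (u' @ d # c # v') = sgnc eps d c * f (u @ a # b # v) (u' @ c # d # v')"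
    using rel[OF x y'] len rop_at[of ?d ?s u _ a b v] rop_at[of ?d ?s u' _ d c v'] by (simp only: d)
  then have "sgnc eps c d * (sgnc eps a b * f (u @ b # a # v) (u' @ d # c # v'))
      = (sgnc eps c d * sgnc eps c d) * f (u @ a # b # v) (u' @ c # d # v')"
    by (simp only: sgnc_simps(3)[of eps d c] mult.assoc)
  then show ?thesis by (simp add: sgnc_simps(2) mult.assoc mult.left_commute)
qed

text \<open>Pairing with a weight idempotent picks out the diagonal sum over that weight; its value
  0 persists at q = 1.\<close>

lemma PhiOrth1_trace:
  assumes f: "f \<in> PhiOrth1 n eps l" and x: "x \<in> Tidx n l"
  shows "(\<Sum>y | mset y = mset x. f y y) = 0"
proof -
  obtain M where M: "M \<in> PhiOrth n eps l" "\<And>x y. x \<in> Tidx n l \<Longrightarrow> y \<in> Tidx n l \<Longrightarrow> at1 (M x y) (f x y)"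
    using f unfolding PhiOrth1_def by blast
  let ?Y = "{y. mset y = mset x}"
  have Y: "?Y = {y \<in> Tidx n l. mset y = mset x}" using Tidx_mset[OF x] by auto
  have "0 = mip n l M (diagm n l (\<lambda>u. if mset u = mset x then 1 else 0))"
    using M(1) weight_idempotent by (simp add: PhiOrth_def)
  also have "\<dots> = (\<Sum>u\<in>Tidx n l. \<Sum>v\<in>Tidx n l. if u = v then if mset u = mset x then M u u else 0 else 0)"
    unfolding mip_def by (intro sum.cong refl) (auto simp: diagm_def)
  also have "\<dots> = (\<Sum>u\<in>?Y. M u u)"
    unfolding Y by (simp add: finite_Tidx sum.inter_filter)
  finally have "(\<Sum>u\<in>?Y. M u u) = 0" by simp
  moreover have "at1 (\<Sum>u\<in>?Y. M u u) (\<Sum>u\<in>?Y. f u u)"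
    unfolding Y by (intro at1_sum M(2)) auto
  ultimately show ?thesis using at1_unique[OF _ at1_0] by metis
qed

lemma PhiOrth_eq_0:
  assumes M: "M \<in> PhiOrth n eps l"
  shows "M = (\<lambda>x y. 0)"
proof (rule ccontr)
  assume "M \<noteq> (\<lambda>x y. 0)"
  moreover have ME: "M \<in> Endo n l" using M by (simp add: PhiOrth_def commutant_def)
  ultimately obtain x0 y0 where "x0 \<in> Tidx n l" "y0 \<in> Tidx n l" "M x0 y0 \<noteq> 0"
    by (metis EndoD)
  then have "(x0, y0) \<in> Tidx n l \<times> Tidx n l" "case_prod M (x0, y0) \<noteq> 0" by auto
  then obtain c g where g: "\<And>p. p \<in> Tidx n l \<times> Tidx n l \<Longrightarrow> at1 (c * case_prod M p) (g p)"
    "\<exists>p\<in>Tidx n l \<times> Tidx n l. g p \<noteq> 0"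
    using scale_at1[of "Tidx n l \<times> Tidx n l" "(x0, y0)" "case_prod M"] finite_Tidx by blast
  have "(\<lambda>x y. c * M x y) \<in> PhiOrth n eps l"
    using M by (auto simp: PhiOrth_def mip_smult_left intro: smult_commutant)
  then have "(\<lambda>x y. g (x, y)) \<in> PhiOrth1 n eps l"
    unfolding PhiOrth1_def using g(1) by fastforce
  then have "g (x, y) = 0" if "x \<in> Tidx n l" "y \<in> Tidx n l" for x y
    using that
  proof (rule ladder_closed_eq_0[of "sgnc eps" "PhiOrth1 n eps l" n l, rotated 5])
    show "(\<lambda>x y. hop (\<lambda>c. sgnc eps b c * sgnc eps a c) (\<lambda>_. 1) b a (\<lambda>u. M u y) x) \<in> PhiOrth1 n eps l"
      if "M \<in> PhiOrth1 n eps l" "a \<noteq> b" "a \<in> {1..n}" "b \<in> {1..n}" for M a b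
      using lad_PhiOrth1[OF that] by (simp add: lad_def)
  qed (auto intro: sgnc_simps PhiOrth1_swap PhiOrth1_trace)
  then show False using g(2) by auto
qed

theorem theorem3p1:
  fixes n l :: nat and eps :: "nat \<Rightarrow> nat"
  assumes "n \<ge> 4"
    and "\<forall>j\<in>{1..n}. eps j \<in> {0, 1}"
    and "eps 1 = 0"
    and "l \<ge> 2"
  shows "commutant n l (PsiImage n eps l) = PhiImage n eps l
       \<and> commutant n l (PhiImage n eps l) = PsiImage n eps l"
proof
  have C: "commutant n l (PsiImage n eps l) = commutant n l (PsiGens n eps l)"
    unfolding PsiImage_def by (rule commutant_alg_gen[OF PsiGens_Endo])
  show *: "commutant n l (PsiImage n eps l) = PhiImage n eps l"
  proof
    show "PhiImage n eps l \<subseteq> commutant n l (PsiImage n eps l)"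
      unfolding C by (rule PhiImage_commutant)
    show "commutant n l (PsiImage n eps l) \<subseteq> PhiImage n eps l"
    proof
      fix M assume M: "M \<in> commutant n l (PsiImage n eps l)"
      \<comment> \<open>\<open>P\<close> is the projection of \<open>M\<close> to the image. Their
        difference lies in the orthogonal complement, hence is 0.\<close>
      obtain P where P: "P \<in> PhiImage n eps l" "\<And>A. A \<in> PhiImage n eps l \<Longrightarrow> mip n l P A = mip n l M A"
        using alg_gen_projection[OF PhiGens_Endo] unfolding PhiImage_def by metis
      have "(\<lambda>x y. M x y + (- 1) * P x y) \<in> commutant n l (PsiGens n eps l)"
        using M P(1) PhiImage_commutant unfolding C by (intro add_commutant smult_commutant) auto
      then have "(\<lambda>x y. M x y + (- 1) * P x y) \<in> PhiOrth n eps l"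
        using P(2) by (simp only: PhiOrth_def mem_Collect_eq mip_add_left mip_smult_left) simp
      then have "(\<lambda>x y. M x y + (- 1) * P x y) = (\<lambda>x y. 0)" by (rule PhiOrth_eq_0)
      then have "M = P" by (simp add: fun_eq_iff)
      then show "M \<in> PhiImage n eps l" using P(1) by simp
    qed
  qed
  show "commutant n l (PhiImage n eps l) = PsiImage n eps l"
  proof
    show "commutant n l (PhiImage n eps l) \<subseteq> PsiImage n eps l"
      \<comment> \<open>By the first equality the left side is the double commutant of the Hecke
        image.\<close>
      unfolding *[symmetric] unfolding PsiImage_def
      by (rule double_commutant[OF PsiGens_Endo mtr_PsiGens])
    show "PsiImage n eps l \<subseteq> commutant n l (PhiImage n eps l)"
      using alg_gen_Endo[OF PsiGens_Endo, of _ n l eps] unfolding *[symmetric]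
      by (auto simp: commutant_def PsiImage_def)
  qed
qed

end
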